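(* Let $\alpha\in(0,1)$, $\lambda^*\in(0,1]$ and $z^*\in\mathbb R\setminus\{0\}$, and let $X_1,\dots,X_n$ be i.i.d. with distribution $P_{\lambda^*,z^*}$. There is a positive constant $C(\alpha,z^*,\lambda^* )$ such that, for any $\rho$-estimator $\hat P=P_{\hat\lambda,\hat z}$ on $\mathscr Q_\delta$ with $\delta=10/n$ and $n\ge20$, for all $\xi>0$, with probability at least $1-e^{-\xi}$, $$C(\alpha,z^*,\lambda^* )\left[1\wedge|\hat z-z^*|^{1-\alpha}+(\lambda^*-\hat\lambda)^2\right]\le\frac{\log(n)+\xi}{n}.$$
   Context: $s_\alpha(x)=\frac{1-\alpha}{2|x|^\alpha}\mathbf 1_{|x|\in(0,1]}$, a probability density on $\mathbb R$ with respect to Lebesgue measure. For $\lambda\in[0,1]$, $z\in\mathbb R$, $p_{\lambda,z}=(1-\lambda)s_\alpha+\lambda s_\alpha(\cdot-z)$ and $P_{\lambda,z}$ is the distribution with density $p_{\lambda,z}$. $a\wedge b=\min(a,b)$. $\mathscr Q_\delta$ is the set of $P_{\lambda,z}$ with $\lambda\in\mathbb Q\cap[\delta,1-\delta]$ and $z\in D$, where $D$ is a fixed at most countable subset of $\mathbb R$ such that the distributions with densities $s_\alpha(\cdot-z)$, $z\in D$, are dense, for the Hellinger distance, among those with $z\in\mathbb R$. $\mathcal Q_\delta$ is the corresponding set of densities. The Hellinger distance is given by $h^2(Q,Q')=\frac12\int(\sqrt{dQ/d\nu}-\sqrt{dQ'/d\nu})^2d\nu$. $\rho$-estimator. With $\mathbf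 X=(X_1,\dots,X_n)$, let $\psi(x)=\frac{x-1}{x+1}$ on $[0,+\infty]$ ($\psi(+\infty)=1$), $\mathbf T(\mathbf X,q,q')=\sum_{i=1}^n\psi\big(\sqrt{q'(X_i)/q(X_i)}\big)$ (with $0/0=1$, $a/0=+\infty$ for $a>0$) and $\mathbf\Upsilon(\mathbf X,q)=\sup_{q'\in\mathcal Q_\delta}\mathbf T(\mathbf X,q,q')$. A $\rho$-estimator on $\mathscr Q_\delta$ is any measurable element of the Hellinger closure of the set of distributions with density $q\in\mathcal Q_\delta$ such that $\mathbf\Upsilon(\mathbf X,q)<\inf_{q'\in\mathcal Q_\delta}\mathbf\Upsilon(\mathbf X,q')+8.24$. *)

theory Defs
  imports "HOL-Probability.Probability"
begin

definition s_dens :: "real \<Rightarrow> real \<Rightarrow> real" where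
  "s_dens \<alpha> x = (1 - \<alpha>) / (2 * \<bar>x\<bar> powr \<alpha>) * indicator {y. \<bar>y\<bar> \<in> {0<..1}} x"

definition mix_dens :: "real \<Rightarrow> real \<Rightarrow> real \<Rightarrow> real \<Rightarrow> real" where
  "mix_dens \<alpha> lam z x = (1 - lam) * s_dens \<alpha> x + lam * s_dens \<alpha> (x - z)"

definition law :: "(real \<Rightarrow> real) \<Rightarrow> real measure" where
  "law q = density lborel (\<lambda>x. ennreal (q x))"

definition mix_law :: "real \<Rightarrow> real \<Rightarrow> real \<Rightarrow> real measure" where
  "mix_law \<alpha> lam z = law (mix_dens \<alpha> lam z)"

(* Meaningful only when nu dominates both Q and Q'. *)
definition hellinger_sq :: "'a measure \<Rightarrow> 'a measure \<Rightarrow> 'a measure \<Rightarrow> real" where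
  "hellinger_sq \<nu> Q Q' =
     1 / 2 * (\<integral>x. (sqrt (enn2real (RN_deriv \<nu> Q x)) - sqrt (enn2real (RN_deriv \<nu> Q' x)))\<^sup>2 \<partial>\<nu>)"

definition hellinger :: "'a measure \<Rightarrow> 'a measure \<Rightarrow> 'a measure \<Rightarrow> real" where
  "hellinger \<nu> Q Q' = sqrt (hellinger_sq \<nu> Q Q')"

(* All distributions considered have Lebesgue densities, so Lebesgue measure serves as the
   dominating measure. A Hellinger limit of Lebesgue-absolutely continuous distributions is again
   absolutely continuous, hence restricting to such P loses no point of the closure; it is needed
   because RN_deriv carries no information about a singular P. *)
definition hellinger_closure :: "real measure set \<Rightarrow> real measure set" where
  "hellinger_closure \<E> =
     {P \<in> space (prob_algebra borel). absolutely_continuous lborel P \<and>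
        (\<forall>\<epsilon>>0. \<exists>Q\<in>\<E>. hellinger lborel P Q < \<epsilon>)}"

definition admissible_shifts :: "real \<Rightarrow> real set \<Rightarrow> bool" where
  "admissible_shifts \<alpha> D \<longleftrightarrow> countable D \<and>
     (\<forall>z. \<forall>\<epsilon>>0. \<exists>d\<in>D.
        hellinger lborel (law (\<lambda>x. s_dens \<alpha> (x - z))) (law (\<lambda>x. s_dens \<alpha> (x - d))) < \<epsilon>)"

definition model_dens :: "real \<Rightarrow> real set \<Rightarrow> real \<Rightarrow> (real \<Rightarrow> real) set" where
  "model_dens \<alpha> D \<delta> = {mix_dens \<alpha> lam z | lam z. lam \<in> \<rat> \<inter> {\<delta>..1 - \<delta>} \<and> z \<in> D}"

definition psi :: "ennreal \<Rightarrow> real" where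
  "psi x = (if x = \<infinity> then 1 else (enn2real x - 1) / (enn2real x + 1))"

definition ext_sqrt :: "ennreal \<Rightarrow> ennreal" where
  "ext_sqrt x = (if x = \<infinity> then \<infinity> else ennreal (sqrt (enn2real x)))"

(* Ennreal division already gives a / 0 = \<infinity> for a > 0, but 0 / 0 = 0. *)
definition dens_ratio :: "real \<Rightarrow> real \<Rightarrow> ennreal" where
  "dens_ratio a b = (if a = 0 \<and> b = 0 then 1 else ennreal a / ennreal b)"

definition T_stat :: "nat \<Rightarrow> (nat \<Rightarrow> real) \<Rightarrow> (real \<Rightarrow> real) \<Rightarrow> (real \<Rightarrow> real) \<Rightarrow> real" where
  "T_stat n x q q' = (\<Sum>i=1..n. psi (ext_sqrt (dens_ratio (q' (x i)) (q (x i)))))"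

(* Each summand of T_stat lies in [-1, 1], so the suprema and infima below are those of bounded
   sets of reals. *)
definition Upsilon :: "(real \<Rightarrow> real) set \<Rightarrow> nat \<Rightarrow> (nat \<Rightarrow> real) \<Rightarrow> (real \<Rightarrow> real) \<Rightarrow> real" where
  "Upsilon \<Q> n x q = (SUP q'\<in>\<Q>. T_stat n x q q')"

definition near_minimizers :: "(real \<Rightarrow> real) set \<Rightarrow> nat \<Rightarrow> (nat \<Rightarrow> real) \<Rightarrow> real measure set" where
  "near_minimizers \<Q> n x =
     law ` {q \<in> \<Q>. Upsilon \<Q> n x q < (INF q'\<in>\<Q>. Upsilon \<Q> n x q') + 8.24}"

(* A random distribution is measurable for the evaluation maps P \<mapsto> P(A). On the (separable)
   space of Lebesgue-absolutely continuous distributions these generate the Borel sigma-algebra of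
   the Hellinger distance. *)
definition rho_estimator ::
  "(real \<Rightarrow> real) set \<Rightarrow> nat \<Rightarrow> ((nat \<Rightarrow> real) \<Rightarrow> real measure) \<Rightarrow> bool" where
  "rho_estimator \<Q> n Phat \<longleftrightarrow>
     Phat \<in> (\<Pi>\<^sub>M i\<in>{1..n}. borel) \<rightarrow>\<^sub>M prob_algebra borel \<and>
     (\<forall>x \<in> space (\<Pi>\<^sub>M i\<in>{1..n}. (borel :: real measure)).
        Phat x \<in> hellinger_closure (near_minimizers \<Q> n x))"

definition iid_sample :: "'a measure \<Rightarrow> nat \<Rightarrow> (nat \<Rightarrow> 'a \<Rightarrow> real) \<Rightarrow> real measure \<Rightarrow> bool" where
  "iid_sample M n X P \<longleftrightarrow> prob_space M \<and>
     prob_space.indep_vars M (\<lambda>_. borel) X {1..n} \<and> (\<forall>i\<in>{1..n}. distr M borel (X i) = P)"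

(* Inner probability: when the event E is measurable this says prob E \<ge> p, and it remains
   meaningful otherwise. Parameters of an estimated mixture need not be measurable: at shift 0
   all weights give the same distribution. *)
definition with_prob_at_least :: "'a measure \<Rightarrow> real \<Rightarrow> ('a \<Rightarrow> bool) \<Rightarrow> bool" where
  "with_prob_at_least M p E \<longleftrightarrow> (\<exists>A\<in>sets M. A \<subseteq> {\<omega>\<in>space M. E \<omega>} \<and> measure M A \<ge> p)"

end

theory Submission
  imports Defs
begin

text \<open>Let \<open>p\<close> be the true density and \<open>hell\<close> the squared Hellinger distance.  The theorem combines two
  facts: a lower bound \<open>hell_mix_ge\<close> of \<open>hell p q\<close> by the loss in the weight and the shift of \<open>q\<close>, and
  the upper bound \<open>rho_estimator_hell_le\<close> of order \<open>(ln n + \<xi>) / n\<close> for the distance of the estimate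
  to \<open>p\<close>.

  The exponent \<open>1 - \<alpha>\<close> in the lower bound comes from the singularity of \<open>p\<close> at the true shift: if the
  competitor is singular elsewhere, at distance \<open>\<Delta>\<close>, then on a neighbourhood of size of order \<open>\<Delta>\<close> its
  density is much smaller than \<open>p\<close>, and \<open>p\<close> gives such a neighbourhood mass of order
  \<open>\<Delta> powr (1 - \<alpha>)\<close>.  Once the shifts are close, the probability of a half-line identifies the weight.

  The upper bound rests on the inequality \<open>exp (\<psi> r / 2) \<le> (3 + r) / 4\<close> for the contrast
  \<open>\<psi> r = (r - 1) / (r + 1)\<close>.  For \<open>r = sqrt (q / qb)\<close> it bounds the exponential moment of the contrast
  under \<open>qb\<close> by \<open>1 - hell q qb / 4\<close>, so that by Chernoff's inequality the statistic \<open>T qb q\<close> is at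
  most of order \<open>ln N + \<xi> - n * hell q qb\<close>, simultaneously for \<open>N\<close> candidates \<open>q\<close>.  Infinitely many
  candidates are reduced to polynomially many by brackets.  The peak of the density moves with the
  shift, so that a function dominating a whole interval of shifts is infinite on an interval; but the
  contrast is at most one, and neighbourhoods of the peak and of the endpoints of the support whose
  size is a suitable power of \<open>1 / n\<close> have probability at most \<open>1 / n\<close> and can be given up.  Elsewhere
  a small shift changes the density only by a factor \<open>1 + O(1 / n)\<close>.

  Finally \<open>qb\<close> is an element of the model at \<open>L1\<close> distance \<open>O(1 / n)\<close> from \<open>p\<close>.  The uniform bound controls
  the supremum of \<open>T qb\<close>, hence the minimal supremum and that of any near-minimiser \<open>q\<close>; by
  antisymmetry of \<open>T\<close> this bounds \<open>T qb q\<close> from below, which forces \<open>hell q qb\<close> to be small.\<close>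

section \<open>Hellinger calculus for Lebesgue densities\<close>

definition prob_dens :: "(real \<Rightarrow> real) \<Rightarrow> bool" where
  "prob_dens f \<longleftrightarrow> f \<in> borel_measurable borel \<and> (\<forall>x. 0 \<le> f x) \<and> integrable lborel f \<and>
     (\<integral>x. f x \<partial>lborel) = 1"

definition hell :: "(real \<Rightarrow> real) \<Rightarrow> (real \<Rightarrow> real) \<Rightarrow> real" where
  "hell f g = 1 / 2 * (\<integral>x. (sqrt (f x) - sqrt (g x))\<^sup>2 \<partial>lborel)"

lemma prob_densD:
  assumes "prob_dens f"
  shows "f \<in> borel_measurable borel" "\<And>x. 0 \<le> f x" "integrable lborel f" "(\<integral>x. f x \<partial>lborel) = 1"
  using assms by (auto simp: prob_dens_def)

text \<open>The Radon-Nikodym derivatives in the definition of the Hellinger distance are almost everywhere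
  the given densities, so that all later work can be done with densities.\<close>

lemma hellinger_sq_law:
  assumes f: "prob_dens f" and g: "prob_dens g"
  shows "hellinger_sq lborel (law f) (law g) = hell f g"
proof -
  note [measurable] = prob_densD(1)[OF f] prob_densD(1)[OF g]
  have rn: "AE x in lborel. enn2real (RN_deriv lborel (law k) x) = k x" if k: "prob_dens k" for k
  proof -
    have [measurable]: "k \<in> borel_measurable borel" using k by (rule prob_densD)
    have "AE x in lborel. ennreal (k x) = RN_deriv lborel (law k) x"
      by (rule sigma_finite_measure.RN_deriv_unique[OF sigma_finite_lborel]) (auto simp: law_def)
    then show ?thesis
    proof eventually_elim
      case (elim x)
      then show ?case using prob_densD(2)[OF k, of x] by (metis enn2real_ennreal)
    qed
  qed
  have "(\<integral>x. (sqrt (enn2real (RN_deriv lborel (law f) x)) - sqrt (enn2real (RN_deriv lborel (law g) x)))\<^sup>2 \<partial>lborel)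
      = (\<integral>x. (sqrt (f x) - sqrt (g x))\<^sup>2 \<partial>lborel)"
  proof (rule integral_cong_AE)
    show "AE x in lborel. (sqrt (enn2real (RN_deriv lborel (law f) x)) - sqrt (enn2real (RN_deriv lborel (law g) x)))\<^sup>2
      = (sqrt (f x) - sqrt (g x))\<^sup>2"
      using rn[OF f] rn[OF g] by eventually_elim simp
  qed measurable
  then show ?thesis by (simp add: hellinger_sq_def hell_def)
qed

lemma hell_nonneg: "0 \<le> hell f g"
  by (simp add: hell_def)

lemma hell_commute: "hell f g = hell g f"
  by (simp add: hell_def power2_commute)

lemma sqrt_mult_le_add: "0 \<le> a \<Longrightarrow> 0 \<le> b \<Longrightarrow> sqrt (a * b) \<le> a + (b::real)"
  using arith_geo_mean_sqrt[of a b] by simp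

lemma integrable_affinity:
  assumes f: "prob_dens f" and g: "prob_dens g"
  shows "integrable lborel (\<lambda>x. sqrt (f x * g x))"
proof (rule Bochner_Integration.integrable_bound[where f="\<lambda>x. f x + g x"])
  note [measurable] = prob_densD(1)[OF f] prob_densD(1)[OF g]
  show "integrable lborel (\<lambda>x. f x + g x)"
    using prob_densD(3)[OF f] prob_densD(3)[OF g] by simp
  show "(\<lambda>x. sqrt (f x * g x)) \<in> borel_measurable lborel" by measurable
  show "AE x in lborel. norm (sqrt (f x * g x)) \<le> norm (f x + g x)"
    using prob_densD(2)[OF f] prob_densD(2)[OF g] by (intro AE_I2) (auto intro!: sqrt_mult_le_add)
qed

lemma sq_diff_sqrt: "0 \<le> a \<Longrightarrow> 0 \<le> b \<Longrightarrow> (sqrt a - sqrt b)\<^sup>2 = a + b - 2 * sqrt (a * (b::real))"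
  by (simp add: power2_diff real_sqrt_mult)

lemma integrable_sq_diff_sqrt:
  assumes f: "prob_dens f" and g: "prob_dens g"
  shows "integrable lborel (\<lambda>x. (sqrt (f x) - sqrt (g x))\<^sup>2)"
  using prob_densD(2,3)[OF f] prob_densD(2,3)[OF g] integrable_affinity[OF f g]
  by (subst sq_diff_sqrt) auto

lemma integral_affinity:
  assumes f: "prob_dens f" and g: "prob_dens g"
  shows "(\<integral>x. sqrt (f x * g x) \<partial>lborel) = 1 - hell f g"
proof -
  have "(\<integral>x. (sqrt (f x) - sqrt (g x))\<^sup>2 \<partial>lborel) = (\<integral>x. f x + g x - 2 * sqrt (f x * g x) \<partial>lborel)"
    using prob_densD(2)[OF f] prob_densD(2)[OF g] by (subst sq_diff_sqrt) auto
  also have "\<dots> = 2 - 2 * (\<integral>x. sqrt (f x * g x) \<partial>lborel)"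
    using prob_densD(3,4)[OF f] prob_densD(3,4)[OF g] integrable_affinity[OF f g] by simp
  finally show ?thesis by (simp add: hell_def diff_divide_distrib)
qed

text \<open>The square root of \<^term>\<open>hell\<close> satisfies the triangle inequality; squaring it costs a
  factor two, which is harmless when only constants are lost.\<close>

lemma hell_triangle:
  assumes f: "prob_dens f" and g: "prob_dens g" and h: "prob_dens h"
  shows "hell f h \<le> 2 * hell f g + 2 * hell g h"
proof -
  have "(\<integral>x. (sqrt (f x) - sqrt (h x))\<^sup>2 \<partial>lborel)
      \<le> (\<integral>x. 2 * (sqrt (f x) - sqrt (g x))\<^sup>2 + 2 * (sqrt (g x) - sqrt (h x))\<^sup>2 \<partial>lborel)"
  proof (rule integral_mono)
    fix x
    define a b where "a = sqrt (f x) - sqrt (g x)" and "b = sqrt (g x) - sqrt (h x)"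
    have "(a + b)\<^sup>2 \<le> 2 * a\<^sup>2 + 2 * b\<^sup>2"
      using zero_le_power2[of "a - b"] by (simp add: power2_eq_square algebra_simps)
    then show "(sqrt (f x) - sqrt (h x))\<^sup>2 \<le> 2 * (sqrt (f x) - sqrt (g x))\<^sup>2 + 2 * (sqrt (g x) - sqrt (h x))\<^sup>2"
      by (simp add: a_def b_def)
  qed (use integrable_sq_diff_sqrt[OF f g] integrable_sq_diff_sqrt[OF g h] integrable_sq_diff_sqrt[OF f h] in auto)
  also have "\<dots> = 2 * (2 * hell f g) + 2 * (2 * hell g h)"
    using integrable_sq_diff_sqrt[OF f g] integrable_sq_diff_sqrt[OF g h] by (simp add: hell_def)
  finally show ?thesis by (simp add: hell_def)
qed

lemma abs_diff_squares:
  fixes a b :: real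
  assumes "0 \<le> a" "0 \<le> b"
  shows "\<bar>a\<^sup>2 - b\<^sup>2\<bar> = \<bar>a - b\<bar> * (a + b)"
proof -
  have "a\<^sup>2 - b\<^sup>2 = (a - b) * (a + b)" by (simp add: power2_eq_square algebra_simps)
  then have "\<bar>a\<^sup>2 - b\<^sup>2\<bar> = \<bar>a - b\<bar> * \<bar>a + b\<bar>" by (simp only: abs_mult)
  then show ?thesis using assms by simp
qed

lemma hell_le_L1:
  assumes f: "prob_dens f" and g: "prob_dens g"
  shows "hell f g \<le> 1 / 2 * (\<integral>x. \<bar>f x - g x\<bar> \<partial>lborel)"
proof -
  have "(\<integral>x. (sqrt (f x) - sqrt (g x))\<^sup>2 \<partial>lborel) \<le> (\<integral>x. \<bar>f x - g x\<bar> \<partial>lborel)"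
  proof (rule integral_mono)
    fix x
    have nn: "0 \<le> f x" "0 \<le> g x" using prob_densD(2)[OF f] prob_densD(2)[OF g] by auto
    define a b where "a = sqrt (f x)" and "b = sqrt (g x)"
    have ab: "0 \<le> a" "0 \<le> b" "f x = a\<^sup>2" "g x = b\<^sup>2" using nn by (auto simp: a_def b_def)
    have "(a - b)\<^sup>2 = \<bar>a - b\<bar> * \<bar>a - b\<bar>" by (simp add: power2_eq_square)
    also have "\<dots> \<le> \<bar>a - b\<bar> * (a + b)" using ab by (intro mult_left_mono) auto
    also have "\<dots> = \<bar>a\<^sup>2 - b\<^sup>2\<bar>"
      using ab by (simp add: abs_diff_squares)
    finally show "(sqrt (f x) - sqrt (g x))\<^sup>2 \<le> \<bar>f x - g x\<bar>" using ab by simp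
  qed (use integrable_sq_diff_sqrt[OF f g] prob_densD(3)[OF f] prob_densD(3)[OF g] in auto)
  then show ?thesis by (simp add: hell_def)
qed

text \<open>Cauchy-Schwarz bounds the \<open>L1\<close> distance by a multiple of the Hellinger distance.  Keeping the
  parameter \<open>t\<close> of the arithmetic-geometric inequality free avoids taking square roots of
  integrals.\<close>

lemma L1_le_hell:
  assumes f: "prob_dens f" and g: "prob_dens g" and t: "0 < t"
  shows "(\<integral>x. \<bar>f x - g x\<bar> \<partial>lborel) \<le> t * hell f g + 2 / t"
proof -
  have "(\<integral>x. \<bar>f x - g x\<bar> \<partial>lborel)
      \<le> (\<integral>x. t / 2 * (sqrt (f x) - sqrt (g x))\<^sup>2 + 1 / t * (f x + g x) \<partial>lborel)"
  proof (rule integral_mono)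
    fix x
    have nn: "0 \<le> f x" "0 \<le> g x" using prob_densD(2)[OF f] prob_densD(2)[OF g] by auto
    define a b where "a = sqrt (f x)" and "b = sqrt (g x)"
    have ab: "0 \<le> a" "0 \<le> b" "f x = a\<^sup>2" "g x = b\<^sup>2" using nn by (auto simp: a_def b_def)
    define u v where "u = \<bar>a - b\<bar>" and "v = a + b"
    have "0 \<le> (t * u - v)\<^sup>2 / (2 * t)" using t by simp
    also have "(t * u - v)\<^sup>2 / (2 * t) = t / 2 * u\<^sup>2 + 1 / (2 * t) * v\<^sup>2 - u * v"
      using t by (simp add: power2_eq_square field_simps)
    finally have "u * v \<le> t / 2 * u\<^sup>2 + 1 / (2 * t) * v\<^sup>2" by simp
    also have "v\<^sup>2 \<le> 2 * (a\<^sup>2 + b\<^sup>2)"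
      using zero_le_power2[of "a - b"] by (simp add: v_def power2_eq_square algebra_simps)
    finally have "u * v \<le> t / 2 * u\<^sup>2 + 1 / t * (a\<^sup>2 + b\<^sup>2)" using t by (simp add: field_simps)
    moreover have "\<bar>a\<^sup>2 - b\<^sup>2\<bar> = u * v"
      using ab by (simp add: u_def v_def abs_diff_squares)
    ultimately show "\<bar>f x - g x\<bar> \<le> t / 2 * (sqrt (f x) - sqrt (g x))\<^sup>2 + 1 / t * (f x + g x)"
      using ab by (simp add: u_def)
  qed (use integrable_sq_diff_sqrt[OF f g] prob_densD(3)[OF f] prob_densD(3)[OF g] in auto)
  also have "\<dots> = t * hell f g + 2 / t"
    using integrable_sq_diff_sqrt[OF f g] prob_densD(3,4)[OF f] prob_densD(3,4)[OF g]
    by (simp add: hell_def)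
  finally show ?thesis .
qed

section \<open>The singular kernel and its mixtures\<close>

lemma s_dens_nonneg: "\<alpha> < 1 \<Longrightarrow> 0 \<le> s_dens \<alpha> x"
  by (simp add: s_dens_def)

lemma s_dens_measurable [measurable]: "s_dens \<alpha> \<in> borel_measurable borel"
  unfolding s_dens_def by measurable

lemma s_dens_eq: "0 < \<bar>x\<bar> \<Longrightarrow> \<bar>x\<bar> \<le> 1 \<Longrightarrow> s_dens \<alpha> x = (1 - \<alpha>) / 2 * \<bar>x\<bar> powr (- \<alpha>)"
  by (simp add: s_dens_def powr_minus field_simps)

lemma s_dens_outside: "1 < \<bar>x\<bar> \<Longrightarrow> s_dens \<alpha> x = 0"
  by (simp add: s_dens_def)

lemma has_bochner_integral_s_dens_centered:
  assumes a: "\<alpha> < 1" and r: "0 \<le> r" "r \<le> 1"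
  shows "has_bochner_integral lborel (\<lambda>x. s_dens \<alpha> x * indicator {-r..r} x) (r powr (1 - \<alpha>))"
proof -
  let ?f = "\<lambda>x::real. (1 - \<alpha>) / 2 * \<bar>x\<bar> powr (- \<alpha>)"
  have "((\<lambda>x. x powr (- \<alpha>)) has_integral (r powr (- \<alpha> + 1) / (- \<alpha> + 1))) {0..r}"
    by (rule has_integral_powr_from_0) (use a r in auto)
  from has_integral_mult_right[OF this, of "(1 - \<alpha>) / 2"]
  have "((\<lambda>x. (1 - \<alpha>) / 2 * x powr (- \<alpha>)) has_integral
      ((1 - \<alpha>) / 2 * (r powr (- \<alpha> + 1) / (- \<alpha> + 1)))) {0..r}" .
  also have "(1 - \<alpha>) / 2 * (r powr (- \<alpha> + 1) / (- \<alpha> + 1)) = r powr (1 - \<alpha>) / 2"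
    using a by (simp add: divide_simps)
  finally have "((\<lambda>x. (1 - \<alpha>) / 2 * x powr (- \<alpha>)) has_integral (r powr (1 - \<alpha>) / 2)) {0..r}" .
  then have pos: "(?f has_integral (r powr (1 - \<alpha>) / 2)) {0..r}"
    by (rule has_integral_eq[rotated]) auto
  have neg: "(?f has_integral (r powr (1 - \<alpha>) / 2)) {-r..-0}"
    by (subst has_integral_reflect_real[symmetric]) (use pos in simp)
  have "(?f has_integral (r powr (1 - \<alpha>) / 2 + r powr (1 - \<alpha>) / 2)) {-r..r}"
    by (rule has_integral_combine[where c=0]) (use pos neg r in auto)
  then have hi: "(?f has_integral (r powr (1 - \<alpha>))) {-r..r}" by simp
  have "integral\<^sup>N lborel (\<lambda>x. ennreal (?f x) * indicator {-r..r} x) = ennreal (r powr (1 - \<alpha>))"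
    by (rule nn_integral_has_integral_lebesgue'[OF _ hi]) (use a in auto)
  also have "integral\<^sup>N lborel (\<lambda>x. ennreal (?f x) * indicator {-r..r} x)
     = integral\<^sup>N lborel (\<lambda>x. ennreal (s_dens \<alpha> x * indicator {-r..r} x))"
  proof (rule nn_integral_cong_AE)
    have "AE x in lborel. x \<noteq> (0::real)" by (rule AE_lborel_singleton)
    then show "AE x in lborel. ennreal (?f x) * indicator {-r..r} x = ennreal (s_dens \<alpha> x * indicator {-r..r} x)"
    proof eventually_elim
      case (elim x)
      show ?case
      proof (cases "x \<in> {-r..r}")
        case True
        then have "0 < \<bar>x\<bar>" "\<bar>x\<bar> \<le> 1" using elim r by auto
        then show ?thesis using True by (simp add: s_dens_eq)
      qed simp
    qed
  qed
  finally show ?thesis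
    by (intro has_bochner_integral_nn_integral) (auto simp: s_dens_nonneg[OF a])
qed

lemma prob_dens_s_dens:
  assumes a: "\<alpha> < 1"
  shows "prob_dens (s_dens \<alpha>)"
proof -
  have "has_bochner_integral lborel (\<lambda>x. s_dens \<alpha> x * indicator {-1..1} x) (1 powr (1 - \<alpha>))"
    by (rule has_bochner_integral_s_dens_centered) (use a in auto)
  also have "(\<lambda>x. s_dens \<alpha> x * indicator {-1..1} x) = s_dens \<alpha>"
    by (auto simp: s_dens_def indicator_def fun_eq_iff)
  finally show ?thesis using s_dens_nonneg[OF a]
    by (auto simp: prob_dens_def has_bochner_integral_iff)
qed

lemma prob_dens_shift:
  assumes f: "prob_dens f"
  shows "prob_dens (\<lambda>x. f (x - z))"
proof -
  have [measurable]: "f \<in> borel_measurable borel" using f by (rule prob_densD)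
  show ?thesis
    using prob_densD[OF f] lborel_integrable_real_affine[of f 1 "-z"] lborel_integral_real_affine[of 1 f "-z"]
    by (simp add: prob_dens_def)
qed

lemma prob_dens_convex:
  assumes f: "prob_dens f" and g: "prob_dens g" and l: "0 \<le> l" "l \<le> 1"
  shows "prob_dens (\<lambda>x. (1 - l) * f x + l * g x)"
  using prob_densD[OF f] prob_densD[OF g] l by (auto simp: prob_dens_def)

lemma prob_dens_mix:
  assumes "\<alpha> < 1" "0 \<le> lam" "lam \<le> 1"
  shows "prob_dens (mix_dens \<alpha> lam z)"
  unfolding mix_dens_def
  by (intro prob_dens_convex prob_dens_shift prob_dens_s_dens assms)

lemma s_dens_le:
  assumes a: "0 < \<alpha>" "\<alpha> < 1" and r: "0 < r" "r \<le> \<bar>x\<bar>"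
  shows "s_dens \<alpha> x \<le> (1 - \<alpha>) / 2 * r powr (- \<alpha>)"
proof (cases "\<bar>x\<bar> \<le> 1")
  case True
  have "\<bar>x\<bar> powr (- \<alpha>) \<le> r powr (- \<alpha>)"
    by (rule powr_mono2') (use a r in auto)
  then show ?thesis using r a True by (subst s_dens_eq) (auto intro!: mult_left_mono)
next
  case False
  then show ?thesis using a r by (simp add: s_dens_outside)
qed

lemma s_dens_ge:
  assumes a: "0 < \<alpha>" "\<alpha> < 1" and r: "0 < \<bar>x\<bar>" "\<bar>x\<bar> \<le> r" "r \<le> 1"
  shows "(1 - \<alpha>) / 2 * r powr (- \<alpha>) \<le> s_dens \<alpha> x"
proof -
  have "r powr (- \<alpha>) \<le> \<bar>x\<bar> powr (- \<alpha>)"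
    by (rule powr_mono2') (use a r in auto)
  then show ?thesis using r a by (subst s_dens_eq) (auto intro!: mult_left_mono)
qed

text \<open>An interval of length \<open>2 r\<close> carries mass of order \<open>r powr (1 - \<alpha>)\<close>, wherever it sits: at distance
  more than \<open>r\<close> from the singularity the kernel is at most a multiple of \<open>r powr (- \<alpha>)\<close>.\<close>

lemma s_dens_interval_mass:
  assumes a: "0 < \<alpha>" "\<alpha> < 1" and r: "0 < r" "r \<le> 1"
  shows "(\<integral>x. s_dens \<alpha> x * indicator {c-r..c+r} x \<partial>lborel) \<le> 2 * r powr (1 - \<alpha>)"
proof -
  let ?k = "(1 - \<alpha>) / 2 * r powr (- \<alpha>)"
  have hb: "has_bochner_integral lborel (\<lambda>x. s_dens \<alpha> x * indicator {-r..r} x) (r powr (1 - \<alpha>))"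
    by (rule has_bochner_integral_s_dens_centered) (use a r in auto)
  have "(\<integral>x. s_dens \<alpha> x * indicator {c-r..c+r} x \<partial>lborel)
      \<le> (\<integral>x. s_dens \<alpha> x * indicator {-r..r} x + ?k * indicator {c-r..c+r} x \<partial>lborel)"
  proof (rule integral_mono)
    show "integrable lborel (\<lambda>x. s_dens \<alpha> x * indicator {c - r..c + r} x)"
      by (rule Bochner_Integration.integrable_bound[OF prob_densD(3)[OF prob_dens_s_dens[OF a(2)]]])
         (auto simp: indicator_def)
    show "integrable lborel (\<lambda>x. s_dens \<alpha> x * indicator {-r..r} x + ?k * indicator {c-r..c+r} x)"
      using hb by (intro Bochner_Integration.integrable_add integrable_mult_right integrable_real_indicator)
        (auto simp: has_bochner_integral_iff emeasure_lborel_Icc_eq)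
    fix x
    have "s_dens \<alpha> x \<le> ?k" if "r < \<bar>x\<bar>" using that by (intro s_dens_le a r) simp
    moreover have "0 \<le> ?k" using a by simp
    ultimately show "s_dens \<alpha> x * indicator {c-r..c+r} x
        \<le> s_dens \<alpha> x * indicator {-r..r} x + ?k * indicator {c-r..c+r} x"
      using s_dens_nonneg[OF a(2), of x] by (cases "r < \<bar>x\<bar>") (auto simp: indicator_def)
  qed
  also have "\<dots> = r powr (1 - \<alpha>) + ?k * (2 * r)"
    using hb r by (subst Bochner_Integration.integral_add) (auto simp: has_bochner_integral_iff)
  also have "?k * (2 * r) = (1 - \<alpha>) * r powr (1 - \<alpha>)"
    using r by (simp add: powr_diff powr_minus field_simps)
  also have "r powr (1 - \<alpha>) + (1 - \<alpha>) * r powr (1 - \<alpha>) \<le> 2 * r powr (1 - \<alpha>)"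
    using a by (simp add: field_simps)
  finally show ?thesis .
qed

lemma integrable_mult_indicator':
  fixes f :: "real \<Rightarrow> real"
  shows "integrable lborel f \<Longrightarrow> A \<in> sets borel \<Longrightarrow> integrable lborel (\<lambda>x. f x * indicator A x)"
  using integrable_mult_indicator[of A lborel f] by (simp add: mult.commute)

lemma s_dens_shift_interval_mass:
  assumes a: "0 < \<alpha>" "\<alpha> < 1" and r: "0 < r" "r \<le> 1"
  shows "(\<integral>x. s_dens \<alpha> (x - z) * indicator {c-r..c+r} x \<partial>lborel) \<le> 2 * r powr (1 - \<alpha>)"
proof -
  have "(\<integral>x. s_dens \<alpha> (x - z) * indicator {c-r..c+r} x \<partial>lborel)
      = (\<integral>x. s_dens \<alpha> x * indicator {c-z-r..c-z+r} x \<partial>lborel)"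
    by (subst lborel_integral_real_affine[of 1 _ z])
       (auto intro!: Bochner_Integration.integral_cong simp: indicator_def)
  then show ?thesis using s_dens_interval_mass[OF a r, of "c - z"] by simp
qed

lemma mix_dens_interval_mass:
  assumes a: "0 < \<alpha>" "\<alpha> < 1" and r: "0 < r" "r \<le> 1" and l: "0 \<le> lam" "lam \<le> 1"
  shows "(\<integral>x. mix_dens \<alpha> lam z x * indicator {c-r..c+r} x \<partial>lborel) \<le> 2 * r powr (1 - \<alpha>)"
proof -
  let ?i = "\<lambda>w. \<integral>x. s_dens \<alpha> (x - w) * indicator {c-r..c+r} x \<partial>lborel"
  have int: "integrable lborel (\<lambda>x. s_dens \<alpha> (x - w) * indicator {c-r..c+r} x)" for w
    by (intro integrable_mult_indicator' prob_densD(3) prob_dens_shift prob_dens_s_dens a) auto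
  have "(\<integral>x. mix_dens \<alpha> lam z x * indicator {c-r..c+r} x \<partial>lborel)
    = (\<integral>x. (1 - lam) * (s_dens \<alpha> (x - 0) * indicator {c-r..c+r} x)
        + lam * (s_dens \<alpha> (x - z) * indicator {c-r..c+r} x) \<partial>lborel)"
    by (rule Bochner_Integration.integral_cong) (auto simp: mix_dens_def algebra_simps)
  also have "\<dots> = (1 - lam) * ?i 0 + lam * ?i z"
    using int[of 0] int[of z] by simp
  also have "\<dots> \<le> (1 - lam) * (2 * r powr (1 - \<alpha>)) + lam * (2 * r powr (1 - \<alpha>))"
    using s_dens_shift_interval_mass[OF a r, of 0 c] s_dens_shift_interval_mass[OF a r, of z c] l
    by (intro add_mono mult_left_mono) auto
  finally show ?thesis by (simp add: algebra_simps)
qed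

section \<open>Identifiability of weight and shift in Hellinger distance\<close>

text \<open>Only the singularity of the true density at \<open>zs\<close> matters here.  Within distance \<open>\<kappa> \<Delta>\<close> of
  \<open>zs\<close>, where \<open>\<Delta>\<close> is \<open>\<bar>z - zs\<bar>\<close> truncated at a constant and \<open>\<kappa>\<close> is a small constant, both
  singularities of the competitor are at distance at least \<open>\<Delta> / 2\<close>, so that the true density
  exceeds four times the competitor whatever its weight.  The squared difference of the roots is
  then at least a quarter of the true density, whose mass near \<open>zs\<close> is of order
  \<open>\<Delta> powr (1 - \<alpha>)\<close>.\<close>

lemma hell_mix_ge_shift:
  assumes a: "0 < \<alpha>" "\<alpha> < 1" and ls: "0 < ls" "ls \<le> 1" and zs: "zs \<noteq> 0"
  obtains c where "0 < c"
    "\<And>lam z. 0 \<le> lam \<Longrightarrow> lam \<le> 1 \<Longrightarrow>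
       c * min 1 (\<bar>z - zs\<bar> powr (1 - \<alpha>)) \<le> hell (mix_dens \<alpha> ls zs) (mix_dens \<alpha> lam z)"
proof -
  \<comment> \<open>\<open>\<kappa> powr \<alpha> \<le> ls / 8\<close> outweighs the factor four and the factor \<open>2 powr \<alpha> \<le> 2\<close> from the distance \<open>\<Delta> / 2\<close>\<close>
  define \<kappa> where "\<kappa> = min (1 / 2) ((ls / 8) powr (1 / \<alpha>))"
  define D0 where "D0 = min 1 (\<bar>zs\<bar> / 2)"
  have k: "0 < \<kappa>" "\<kappa> \<le> 1 / 2" using ls by (auto simp: \<kappa>_def)
  have D0: "0 < D0" "D0 \<le> 1" "2 * D0 \<le> \<bar>zs\<bar>" using zs by (auto simp: D0_def)
  have ka: "\<kappa> powr \<alpha> \<le> ls / 8"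
  proof -
    have "\<kappa> powr \<alpha> \<le> ((ls / 8) powr (1 / \<alpha>)) powr \<alpha>"
      by (rule powr_mono2) (use a k in \<open>auto simp: \<kappa>_def\<close>)
    then show ?thesis using a ls by (simp add: powr_powr)
  qed
  define c where "c = ls * (1 - \<alpha>) / 16 * (\<kappa> powr (1 - \<alpha>)) * (D0 powr (1 - \<alpha>))"
  have "0 < c" using a ls k D0 by (simp add: c_def)
  moreover have "c * min 1 (\<bar>z - zs\<bar> powr (1 - \<alpha>)) \<le> hell (mix_dens \<alpha> ls zs) (mix_dens \<alpha> lam z)"
    if lam: "0 \<le> lam" "lam \<le> 1" for lam z
  proof (cases "z = zs")
    case True
    then show ?thesis by (simp add: hell_nonneg)
  next
    case False
    let ?p = "mix_dens \<alpha> ls zs" and ?q = "mix_dens \<alpha> lam z"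
    have p: "prob_dens ?p" and q: "prob_dens ?q" using a ls lam by (auto intro: prob_dens_mix)
    define \<Delta> where "\<Delta> = min D0 \<bar>z - zs\<bar>"
    have D: "0 < \<Delta>" "\<Delta> \<le> D0" "\<Delta> \<le> \<bar>z - zs\<bar>" using False D0 by (auto simp: \<Delta>_def)
    have kD: "0 < \<kappa> * \<Delta>" "\<kappa> * \<Delta> \<le> \<Delta> / 2" "\<kappa> * \<Delta> \<le> 1"
    proof -
      show "0 < \<kappa> * \<Delta>" using k D by simp
      show *: "\<kappa> * \<Delta> \<le> \<Delta> / 2" using mult_right_mono[OF k(2), of \<Delta>] D by simp
      show "\<kappa> * \<Delta> \<le> 1" using * D D0 by linarith
    qed
    define P0 where "P0 = ls * ((1 - \<alpha>) / 2 * (\<kappa> * \<Delta>) powr (- \<alpha>))"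
    have P0: "0 \<le> P0" using a ls by (simp add: P0_def)
    have key: "P0 / 4 * indicator {zs<..zs + \<kappa> * \<Delta>} x \<le> (sqrt (?p x) - sqrt (?q x))\<^sup>2" for x
    proof (cases "x \<in> {zs<..zs + \<kappa> * \<Delta>}")
      case True
      then have x: "0 < \<bar>x - zs\<bar>" "\<bar>x - zs\<bar> \<le> \<kappa> * \<Delta>" by auto
      have "P0 \<le> ls * s_dens \<alpha> (x - zs)"
        unfolding P0_def using s_dens_ge[OF a x kD(3)] ls by (intro mult_left_mono) auto
      also have "\<dots> \<le> ?p x" using s_dens_nonneg[OF a(2), of x] ls by (simp add: mix_dens_def)
      finally have pP: "P0 \<le> ?p x" .
      have x0: "\<Delta> / 2 \<le> \<bar>x\<bar>" using x kD D D0 by linarith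
      have xz: "\<Delta> / 2 \<le> \<bar>x - z\<bar>" using x kD D by linarith
      let ?B = "(1 - \<alpha>) / 2 * (\<Delta> / 2) powr (- \<alpha>)"
      have "?q x \<le> (1 - lam) * ?B + lam * ?B"
        unfolding mix_dens_def using s_dens_le[OF a _ x0] s_dens_le[OF a _ xz] D lam
        by (intro add_mono mult_left_mono) auto
      also have "\<dots> = (1 - lam + lam) * ?B" by (simp only: distrib_right)
      also have "\<dots> = ?B" by simp
      also have "\<dots> \<le> P0 / 4"
      proof -
        have "(2::real) powr \<alpha> \<le> 2 powr 1" by (rule powr_mono) (use a in auto)
        then have "4 * (2 powr \<alpha>) * (\<kappa> powr \<alpha>) \<le> 4 * 2 * (ls / 8)"
          using ka by (intro mult_mono) auto
        then have "4 * (2 powr \<alpha>) \<le> ls * \<kappa> powr (- \<alpha>)"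
          using k by (simp add: powr_minus field_simps)
        then have "4 * (2 powr \<alpha>) * \<Delta> powr (- \<alpha>) \<le> ls * \<kappa> powr (- \<alpha>) * \<Delta> powr (- \<alpha>)"
          by (rule mult_right_mono) simp
        then have "4 * ((\<Delta> / 2) powr (- \<alpha>)) \<le> ls * (\<kappa> * \<Delta>) powr (- \<alpha>)"
          using D k by (simp add: powr_mult powr_divide powr_minus field_simps)
        from mult_left_mono[OF this, of "(1 - \<alpha>) / 2"] show ?thesis
          using a by (simp add: P0_def)
      qed
      finally have "?q x \<le> ?p x / 4" using pP by simp
      then have "sqrt (?q x) \<le> sqrt (?p x / 4)" by simp
      then have "sqrt (?q x) \<le> sqrt (?p x) / 2" by (simp add: real_sqrt_divide)
      then have "(sqrt (?p x) / 2)\<^sup>2 \<le> (sqrt (?p x) - sqrt (?q x))\<^sup>2"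
        using prob_densD(2)[OF p, of x] by (intro power_mono) auto
      then show ?thesis using pP True prob_densD(2)[OF p, of x] by (simp add: power_divide)
    qed simp
    have "P0 / 4 * (\<kappa> * \<Delta>) = (\<integral>x. P0 / 4 * indicator {zs<..zs + \<kappa> * \<Delta>} x \<partial>lborel)"
      using kD by simp
    also have "\<dots> \<le> (\<integral>x. (sqrt (?p x) - sqrt (?q x))\<^sup>2 \<partial>lborel)"
      by (intro integral_mono integrable_sq_diff_sqrt p q key integrable_mult_right integrable_real_indicator)
        (use less_imp_le[OF kD(1)] in auto)
    finally have "P0 / 8 * (\<kappa> * \<Delta>) \<le> hell ?p ?q" unfolding hell_def by linarith
    also have "P0 / 8 * (\<kappa> * \<Delta>) = ls * (1 - \<alpha>) / 16 * (\<kappa> * \<Delta>) powr (1 - \<alpha>)"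
      using kD by (simp add: P0_def powr_diff powr_minus field_simps)
    also have "\<dots> = ls * (1 - \<alpha>) / 16 * (\<kappa> powr (1 - \<alpha>)) * \<Delta> powr (1 - \<alpha>)"
      using k D by (simp add: powr_mult)
    finally have h: "ls * (1 - \<alpha>) / 16 * (\<kappa> powr (1 - \<alpha>)) * \<Delta> powr (1 - \<alpha>) \<le> hell ?p ?q" .
    have "D0 powr (1 - \<alpha>) * min 1 (\<bar>z - zs\<bar> powr (1 - \<alpha>)) \<le> \<Delta> powr (1 - \<alpha>)"
    proof (cases "D0 \<le> \<bar>z - zs\<bar>")
      case True
      have "D0 powr (1 - \<alpha>) * min 1 (\<bar>z - zs\<bar> powr (1 - \<alpha>)) \<le> D0 powr (1 - \<alpha>) * 1"
        by (intro mult_left_mono) auto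
      then show ?thesis using True by (simp add: \<Delta>_def)
    next
      case le: False
      have "D0 powr (1 - \<alpha>) \<le> 1" using D0 a by (intro powr_le1) auto
      then have "D0 powr (1 - \<alpha>) * min 1 (\<bar>z - zs\<bar> powr (1 - \<alpha>)) \<le> 1 * \<bar>z - zs\<bar> powr (1 - \<alpha>)"
        by (intro mult_mono) auto
      then show ?thesis using le by (simp add: \<Delta>_def)
    qed
    then have "c * min 1 (\<bar>z - zs\<bar> powr (1 - \<alpha>))
        \<le> ls * (1 - \<alpha>) / 16 * (\<kappa> powr (1 - \<alpha>)) * \<Delta> powr (1 - \<alpha>)"
      unfolding c_def mult.assoc using ls a by (intro mult_left_mono) auto
    with h show ?thesis by linarith
  qed
  ultimately show ?thesis using that by blast
qed

definition s_cdf :: "real \<Rightarrow> real \<Rightarrow> real" where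
  "s_cdf \<alpha> v = (\<integral>x. s_dens \<alpha> x * indicator {..v} x \<partial>lborel)"

lemma s_cdf_diff:
  assumes a: "\<alpha> < 1" and uv: "u \<le> v"
  shows "s_cdf \<alpha> v - s_cdf \<alpha> u = (\<integral>x. s_dens \<alpha> x * indicator {u<..v} x \<partial>lborel)"
proof -
  note int = integrable_mult_indicator'[OF prob_densD(3)[OF prob_dens_s_dens[OF a]]]
  have "s_cdf \<alpha> v - s_cdf \<alpha> u = (\<integral>x. s_dens \<alpha> x * indicator {..v} x - s_dens \<alpha> x * indicator {..u} x \<partial>lborel)"
    unfolding s_cdf_def using int by (subst Bochner_Integration.integral_diff) auto
  also have "\<dots> = (\<integral>x. s_dens \<alpha> x * indicator {u<..v} x \<partial>lborel)"
    using uv by (intro Bochner_Integration.integral_cong) (auto simp: indicator_def)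
  finally show ?thesis .
qed

lemma s_cdf_modulus:
  assumes a: "0 < \<alpha>" "\<alpha> < 1"
  shows "\<bar>s_cdf \<alpha> v - s_cdf \<alpha> u\<bar> \<le> 2 * min 1 (\<bar>v - u\<bar> powr (1 - \<alpha>))"
proof -
  have *: "\<bar>s_cdf \<alpha> v - s_cdf \<alpha> u\<bar> \<le> 2 * min 1 (\<bar>v - u\<bar> powr (1 - \<alpha>))" if uv: "u < v" for u v
  proof -
    note dens = prob_densD[OF prob_dens_s_dens[OF a(2)]]
    have nn: "0 \<le> (\<integral>x. s_dens \<alpha> x * indicator {u<..v} x \<partial>lborel)"
      using dens(2) by (intro Bochner_Integration.integral_nonneg) auto
    have "(\<integral>x. s_dens \<alpha> x * indicator {u<..v} x \<partial>lborel) \<le> (\<integral>x. s_dens \<alpha> x \<partial>lborel)"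
      using dens by (intro integral_mono integrable_mult_indicator') (auto simp: indicator_def)
    then have le1: "(\<integral>x. s_dens \<alpha> x * indicator {u<..v} x \<partial>lborel) \<le> 1" using dens(4) by simp
    define r c where "r = (v - u) / 2" and "c = (u + v) / 2"
    have "(\<integral>x. s_dens \<alpha> x * indicator {u<..v} x \<partial>lborel) \<le> 2 * (v - u) powr (1 - \<alpha>)" if "r \<le> 1"
    proof -
      have "(\<integral>x. s_dens \<alpha> x * indicator {u<..v} x \<partial>lborel) \<le> (\<integral>x. s_dens \<alpha> x * indicator {c-r..c+r} x \<partial>lborel)"
      proof (rule integral_mono)
        fix x
        have cr: "c - r = u" "c + r = v" by (auto simp: c_def r_def field_simps)
        show "s_dens \<alpha> x * indicator {u<..v} x \<le> s_dens \<alpha> x * indicator {c-r..c+r} x"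
          unfolding cr using dens(2)[of x] by (auto simp: indicator_def)
      qed (use dens in \<open>auto intro!: integrable_mult_indicator'\<close>)
      also have "\<dots> \<le> 2 * r powr (1 - \<alpha>)"
        by (rule s_dens_interval_mass[OF a]) (use uv that in \<open>auto simp: r_def\<close>)
      also have "r powr (1 - \<alpha>) \<le> (v - u) powr (1 - \<alpha>)"
        using a uv by (intro powr_mono2) (auto simp: r_def)
      finally show ?thesis by simp
    qed
    moreover have "1 \<le> (v - u) powr (1 - \<alpha>)" if "1 < r"
      using that a by (intro ge_one_powr_ge_zero) (auto simp: r_def)
    ultimately show ?thesis
      using nn le1 s_cdf_diff[OF a(2), of u v] uv by (cases "r \<le> 1") (auto simp: min_def)
  qed
  show ?thesis
    using *[of u v] *[of v u] by (cases u v rule: linorder_cases) (auto simp: abs_minus_commute)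
qed

text \<open>The kernel is at least \<open>(1 - \<alpha>) / 2\<close> on its support minus the origin.\<close>

lemma s_cdf_separation:
  assumes a: "0 < \<alpha>" "\<alpha> < 1"
  shows "(1 - \<alpha>) / 2 * min 1 \<bar>v\<bar> \<le> \<bar>s_cdf \<alpha> v - s_cdf \<alpha> 0\<bar>"
proof -
  note dens = prob_densD[OF prob_dens_s_dens[OF a(2)]]
  let ?w = "min 1 \<bar>v\<bar>"
  have *: "(1 - \<alpha>) / 2 * ?w \<le> (\<integral>x. s_dens \<alpha> x * indicator {u<..w} x \<partial>lborel)"
    if uw: "(u = 0 \<and> w = v) \<or> (u = v \<and> w = 0)" "u \<le> w" for u w
  proof -
    let ?A = "if u = 0 then {0<..<?w} else {-?w<..<0}"
    have "(1 - \<alpha>) / 2 * ?w = (\<integral>x. (1 - \<alpha>) / 2 * indicator ?A x \<partial>lborel)" by simp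
    also have "\<dots> \<le> (\<integral>x. s_dens \<alpha> x * indicator {u<..w} x \<partial>lborel)"
    proof (rule integral_mono)
      show "integrable lborel (\<lambda>x. (1 - \<alpha>) / 2 * indicator ?A x)"
        by (intro integrable_mult_right integrable_real_indicator) auto
      show "integrable lborel (\<lambda>x. s_dens \<alpha> x * indicator {u<..w} x)"
        using dens by (intro integrable_mult_indicator') auto
      fix x
      show "(1 - \<alpha>) / 2 * indicator ?A x \<le> s_dens \<alpha> x * indicator {u<..w} x"
      proof (cases "x \<in> ?A")
        case True
        then have "0 < \<bar>x\<bar>" "\<bar>x\<bar> \<le> 1" "x \<in> {u<..w}"
          using uw by (auto split: if_splits)
        then show ?thesis using s_dens_ge[OF a, of x 1] True by simp
      next
        case False
        then show ?thesis using dens(2)[of x] by simp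
      qed
    qed
    finally show ?thesis .
  qed
  show ?thesis
  proof (cases "0 \<le> v")
    case True
    then show ?thesis using *[of 0 v] s_cdf_diff[OF a(2), of 0 v] by linarith
  next
    case False
    then show ?thesis using *[of v 0] s_cdf_diff[OF a(2), of v 0] by linarith
  qed
qed

lemma mix_dens_half_line:
  assumes a: "\<alpha> < 1"
  shows "(\<integral>x. mix_dens \<alpha> lam z x * indicator {..0} x \<partial>lborel)
    = (1 - lam) * s_cdf \<alpha> 0 + lam * s_cdf \<alpha> (- z)"
proof -
  have int: "integrable lborel (\<lambda>x. s_dens \<alpha> (x - w) * indicator {..0} x)" for w
    by (intro integrable_mult_indicator' prob_densD(3) prob_dens_shift prob_dens_s_dens a) auto
  have cdf: "(\<integral>x. s_dens \<alpha> (x - w) * indicator {..0} x \<partial>lborel) = s_cdf \<alpha> (- w)" for w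
    unfolding s_cdf_def by (subst lborel_integral_real_affine[of 1 _ w])
       (auto intro!: Bochner_Integration.integral_cong simp: indicator_def)
  have "(\<integral>x. mix_dens \<alpha> lam z x * indicator {..0} x \<partial>lborel)
    = (\<integral>x. (1 - lam) * (s_dens \<alpha> (x - 0) * indicator {..0} x)
        + lam * (s_dens \<alpha> (x - z) * indicator {..0} x) \<partial>lborel)"
    by (rule Bochner_Integration.integral_cong) (auto simp: mix_dens_def algebra_simps)
  also have "\<dots> = (1 - lam) * s_cdf \<alpha> 0 + lam * s_cdf \<alpha> (- z)"
    using int[of 0] int[of z] cdf[of 0] cdf[of z] by simp
  finally show ?thesis .
qed

text \<open>The weight is read off from the probability of the half-line \<open>{..0}\<close>.  Replacing \<open>(ls, zs)\<close> by
  \<open>(lam, z)\<close> changes this probability by a nonzero multiple of \<open>ls - lam\<close>, up to an error of order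
  \<open>min 1 (\<bar>z - zs\<bar> powr (1 - \<alpha>))\<close> which the preceding bound on the shift absorbs.\<close>

lemma hell_mix_ge:
  assumes a: "0 < \<alpha>" "\<alpha> < 1" and ls: "0 < ls" "ls \<le> 1" and zs: "zs \<noteq> 0"
  obtains c where "0 < c"
    "\<And>lam z. 0 \<le> lam \<Longrightarrow> lam \<le> 1 \<Longrightarrow>
       c * (min 1 (\<bar>z - zs\<bar> powr (1 - \<alpha>)) + (ls - lam)\<^sup>2) \<le> hell (mix_dens \<alpha> ls zs) (mix_dens \<alpha> lam z)"
proof -
  obtain c1 where c1: "0 < c1" and sh: "\<And>lam z. 0 \<le> lam \<Longrightarrow> lam \<le> 1 \<Longrightarrow>
       c1 * min 1 (\<bar>z - zs\<bar> powr (1 - \<alpha>)) \<le> hell (mix_dens \<alpha> ls zs) (mix_dens \<alpha> lam z)"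
    using hell_mix_ge_shift[OF a ls zs] by blast
  define m where "m = \<bar>s_cdf \<alpha> (- zs) - s_cdf \<alpha> 0\<bar>"
  have m: "0 < m"
  proof -
    have "0 < (1 - \<alpha>) / 2 * min 1 \<bar>- zs\<bar>" using a zs by simp
    then show ?thesis using s_cdf_separation[OF a, of "- zs"] unfolding m_def by linarith
  qed
  define K where "K = 2 * (4 + 2 * m / c1) / m\<^sup>2"
  have K: "0 < K" using m c1 by (simp add: K_def add_pos_pos)
  define c where "c = 1 / (1 / c1 + K)"
  have "0 < c" using c1 K by (simp add: c_def add_pos_pos)
  moreover have "c * (min 1 (\<bar>z - zs\<bar> powr (1 - \<alpha>)) + (ls - lam)\<^sup>2) \<le> hell (mix_dens \<alpha> ls zs) (mix_dens \<alpha> lam z)"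
    if lam: "0 \<le> lam" "lam \<le> 1" for lam z
  proof -
    let ?p = "mix_dens \<alpha> ls zs" and ?q = "mix_dens \<alpha> lam z"
    define H x0 D where "H = hell ?p ?q" and "x0 = min 1 (\<bar>z - zs\<bar> powr (1 - \<alpha>))" and "D = \<bar>ls - lam\<bar>"
    have p: "prob_dens ?p" and q: "prob_dens ?q" using a ls lam by (auto intro: prob_dens_mix)
    have H: "0 \<le> H" "x0 \<le> H / c1" using sh[OF lam, of z] c1 by (auto simp: H_def x0_def hell_nonneg field_simps)
    have D: "0 \<le> D" "D \<le> 1" using ls lam by (auto simp: D_def)
    have main: "m * D \<le> t * H + 2 / t + 2 * x0" if t: "0 < t" for t
    proof -
      let ?I = "\<lambda>f. \<integral>x. f x * indicator {..0} x \<partial>lborel"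
      have ip: "integrable lborel (\<lambda>x. ?p x * indicator {..0} x)"
        using prob_densD(3)[OF p] by (intro integrable_mult_indicator') auto
      have iq: "integrable lborel (\<lambda>x. ?q x * indicator {..0} x)"
        using prob_densD(3)[OF q] by (intro integrable_mult_indicator') auto
      have "\<bar>?I ?p - ?I ?q\<bar> = \<bar>\<integral>x. ?p x * indicator {..0} x - ?q x * indicator {..0} x \<partial>lborel\<bar>"
        using ip iq by (subst Bochner_Integration.integral_diff) auto
      also have "\<dots> \<le> (\<integral>x. \<bar>?p x - ?q x\<bar> \<partial>lborel)"
      proof (rule order_trans[OF integral_abs_bound], rule integral_mono)
        show "integrable lborel (\<lambda>x. \<bar>?p x * indicator {..0} x - ?q x * indicator {..0} x\<bar>)"
          using ip iq by auto
        show "integrable lborel (\<lambda>x. \<bar>?p x - ?q x\<bar>)"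
          using prob_densD(3)[OF p] prob_densD(3)[OF q] by auto
      qed (auto simp: indicator_def)
      also have "\<dots> \<le> t * H + 2 / t" unfolding H_def by (rule L1_le_hell[OF p q t])
      finally have diff: "\<bar>?I ?p - ?I ?q\<bar> \<le> t * H + 2 / t" .
      have e: "?I ?p - ?I ?q = (ls - lam) * (s_cdf \<alpha> (- zs) - s_cdf \<alpha> 0) + lam * (s_cdf \<alpha> (- zs) - s_cdf \<alpha> (- z))"
        unfolding mix_dens_half_line[OF a(2)] by (simp add: algebra_simps)
      have "\<bar>lam * (s_cdf \<alpha> (- zs) - s_cdf \<alpha> (- z))\<bar> \<le> 1 * (2 * x0)"
        unfolding abs_mult using s_cdf_modulus[OF a, of "- zs" "- z"] lam
        by (intro mult_mono) (auto simp: x0_def)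
      moreover have "\<bar>(ls - lam) * (s_cdf \<alpha> (- zs) - s_cdf \<alpha> 0)\<bar> = m * D"
        by (simp add: abs_mult m_def D_def)
      ultimately show ?thesis using diff e by linarith
    qed
    have "D\<^sup>2 \<le> K * H"
    proof (cases "D = 0")
      case True
      then show ?thesis using H K by simp
    next
      case False
      then have D0: "0 < D" using D by simp
      \<comment> \<open>this choice makes the term \<open>2 / t\<close> half of the left-hand side\<close>
      have "m * D \<le> 4 / (m * D) * H + 2 / (4 / (m * D)) + 2 * x0"
        by (rule main) (use m D0 in simp)
      also have "\<dots> \<le> 4 / (m * D) * H + m * D / 2 + 2 * (H / c1)"
        using H(2) by (intro add_mono mult_left_mono) (use m D0 in \<open>auto simp: mult.commute\<close>)
      finally have "m * D / 2 \<le> 4 / (m * D) * H + 2 * (H / c1)" by simp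
      from mult_left_mono[OF this, of "m * D"] have "(m * D)\<^sup>2 / 2 \<le> 4 * H + 2 * (m * D) * (H / c1)"
        using m D0 by (simp add: power2_eq_square algebra_simps)
      also have "2 * (m * D) * (H / c1) \<le> 2 * (m * 1) * (H / c1)"
        using m D H c1 by (intro mult_right_mono mult_left_mono) auto
      finally have "m\<^sup>2 * D\<^sup>2 / 2 \<le> (4 + 2 * m / c1) * H" by (simp add: power_mult_distrib algebra_simps)
      then show ?thesis using m by (simp add: K_def field_simps)
    qed
    then have "x0 + D\<^sup>2 \<le> (1 / c1 + K) * H" using H by (simp add: algebra_simps)
    moreover have "0 < 1 / c1 + K" using c1 K by (simp add: add_pos_pos)
    ultimately have "c * (x0 + D\<^sup>2) \<le> H" by (simp add: c_def field_simps)
    then show ?thesis by (simp add: H_def x0_def D_def)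
  qed
  ultimately show ?thesis using that by blast
qed

section \<open>The contrast of the estimator\<close>

text \<open>The ratio form extends \<open>\<psi> (sqrt (a / b))\<close> to vanishing arguments with the right conventions:
  division by zero gives \<open>0\<close> at \<open>a = b = 0\<close>, which is \<open>\<psi> 1\<close>, and the value at \<open>b = 0 < a\<close> is \<open>1\<close>.\<close>

definition root_contrast :: "real \<Rightarrow> real \<Rightarrow> real" where
  "root_contrast a b = (sqrt a - sqrt b) / (sqrt a + sqrt b)"

lemma psi_dens_ratio:
  assumes a: "0 \<le> a" and b: "0 \<le> b"
  shows "psi (ext_sqrt (dens_ratio a b)) = root_contrast a b"
proof (cases "b = 0")
  case True
  show ?thesis
  proof (cases "a = 0")
    case True
    then show ?thesis using \<open>b = 0\<close> by (simp add: psi_def ext_sqrt_def dens_ratio_def root_contrast_def)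
  next
    case False
    then have "ennreal a / ennreal b = \<infinity>" using \<open>b = 0\<close> a by simp
    then show ?thesis using False \<open>b = 0\<close> a
      by (simp add: psi_def ext_sqrt_def dens_ratio_def root_contrast_def)
  qed
next
  case False
  then have b0: "0 < b" using b by simp
  have "dens_ratio a b = ennreal (a / b)"
    using False a b0 by (simp add: dens_ratio_def divide_ennreal)
  then have "psi (ext_sqrt (dens_ratio a b)) = (sqrt (a / b) - 1) / (sqrt (a / b) + 1)"
    using a b by (simp add: psi_def ext_sqrt_def)
  also have "\<dots> = root_contrast a b"
    using b0 a by (simp add: root_contrast_def real_sqrt_divide divide_simps) 
  finally show ?thesis .
qed

lemma root_contrast_commute: "root_contrast b a = - root_contrast a b"
  by (simp add: root_contrast_def add.commute minus_divide_left)

lemma root_contrast_abs_le_1: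
  assumes "0 \<le> a" "0 \<le> b"
  shows "\<bar>root_contrast a b\<bar> \<le> 1"
proof -
  have le: "\<bar>sqrt a - sqrt b\<bar> \<le> sqrt a + sqrt b"
    using real_sqrt_ge_zero[OF assms(1)] real_sqrt_ge_zero[OF assms(2)] by linarith
  then have "\<bar>root_contrast a b\<bar> = \<bar>sqrt a - sqrt b\<bar> / (sqrt a + sqrt b)"
    by (simp add: root_contrast_def abs_divide)
  also have "\<dots> \<le> 1" using le by (intro divide_le_eq_1[THEN iffD2]) linarith
  finally show ?thesis .
qed

lemma root_contrast_mono:
  assumes "0 \<le> a" "a \<le> a'" "0 \<le> b"
  shows "root_contrast a b \<le> root_contrast a' b"
proof (cases "b = 0")
  case True
  then show ?thesis using assms by (auto simp: root_contrast_def)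
next
  case False
  define u u' v where "u = sqrt a" "u' = sqrt a'" "v = sqrt b"
  have "0 \<le> u" "u \<le> u'" "0 < v" using assms False by (auto simp: u_u'_v_def)
  then have "(u - v) / (u + v) \<le> (u' - v) / (u' + v)"
    by (simp add: frac_le_eq divide_le_0_iff) (simp add: algebra_simps)
  then show ?thesis by (simp add: root_contrast_def u_u'_v_def)
qed

lemma exp_le_quadratic:
  fixes y :: real
  assumes "y \<le> 1"
  shows "exp y \<le> 1 + y + y\<^sup>2"
proof (cases "0 \<le> y")
  case True
  then show ?thesis using assms by (intro exp_bound)
next
  case False
  have "0 \<le> (- y) ^ 3" using False by (intro zero_le_power) simp
  then have "0 \<le> y\<^sup>2 / 2 + (- y) ^ 3 / 2 + y ^ 4 / 2" by (intro add_nonneg_nonneg) auto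
  also have "\<dots> = (1 + y + y\<^sup>2) * (1 - y + y\<^sup>2 / 2) - 1"
    by (simp add: power2_eq_square power3_eq_cube power4_eq_xxxx field_simps)
  finally have "1 \<le> (1 + y + y\<^sup>2) * (1 - y + y\<^sup>2 / 2)" by simp
  also have "\<dots> \<le> (1 + y + y\<^sup>2) * exp (- y)"
  proof (rule mult_left_mono)
    show "1 - y + y\<^sup>2 / 2 \<le> exp (- y)" using exp_lower_Taylor_quadratic[of "- y"] False by simp
    have "0 \<le> (y + 1 / 2)\<^sup>2 + 3 / 4" by simp
    then show "0 \<le> 1 + y + y\<^sup>2" by (simp add: power2_eq_square algebra_simps)
  qed
  finally show ?thesis by (simp add: exp_minus field_simps)
qed

text \<open>This inequality is the source of all deviation bounds: after integration the right-hand side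
  becomes one minus a quarter of the squared Hellinger distance.  With \<open>r = sqrt (a / b)\<close> it reads
  \<open>exp ((r - 1) / (2 (r + 1))) \<le> (3 + r) / 4\<close>, which a quadratic bound on the exponential reduces to
  \<open>0 \<le> r (r - 1)\<^sup>2\<close>.\<close>

lemma exp_root_contrast_le:
  assumes a: "0 \<le> a" and b: "0 \<le> b"
  shows "b * exp (root_contrast a b / 2) \<le> (3 * b + sqrt (a * b)) / 4"
proof (cases "b = 0")
  case False
  define r where "r = sqrt a / sqrt b"
  have r: "0 \<le> r" using a b by (simp add: r_def)
  have sb: "0 < sqrt b" using b False by simp
  have ra: "sqrt a = r * sqrt b" using sb by (simp add: r_def)
  have rc: "root_contrast a b = (r - 1) / (r + 1)"
  proof -
    from ra have "root_contrast a b = (sqrt b * (r - 1)) / (sqrt b * (r + 1))"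
      by (simp add: root_contrast_def algebra_simps)
    then show ?thesis using sb by simp
  qed
  define y where "y = (r - 1) / (r + 1) / 2"
  have "y \<le> 1" using r by (simp add: y_def divide_simps)
  then have "exp y \<le> 1 + y + y\<^sup>2" by (rule exp_le_quadratic)
  also have "\<dots> \<le> (3 + r) / 4"
  proof -
    have "(3 + r) / 4 - (1 + y + y\<^sup>2) = r * (r - 1)\<^sup>2 / (4 * (r + 1)\<^sup>2)"
      using r unfolding y_def
      by (simp add: power2_eq_square divide_simps) (simp add: algebra_simps)
    moreover have "0 \<le> r * (r - 1)\<^sup>2 / (4 * (r + 1)\<^sup>2)" using r by simp
    ultimately show ?thesis by linarith
  qed
  finally have "b * exp y \<le> b * ((3 + r) / 4)" using b by (rule mult_left_mono)
  also have "b * r = sqrt (a * b)"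
  proof -
    have "sqrt (a * b) = r * (sqrt b * sqrt b)" unfolding real_sqrt_mult ra by (simp only: mult.assoc)
    then show ?thesis using b by simp
  qed
  then have "b * ((3 + r) / 4) = (3 * b + sqrt (a * b)) / 4" by (simp add: algebra_simps)
  finally show ?thesis by (simp add: rc y_def)
qed simp

lemma root_contrast_measurable [measurable]:
  assumes [measurable]: "f \<in> borel_measurable M" "g \<in> borel_measurable M"
  shows "(\<lambda>x. root_contrast (f x) (g x)) \<in> borel_measurable M"
  unfolding root_contrast_def by measurable

lemma T_stat_eq:
  assumes "\<And>y. 0 \<le> q y" "\<And>y. 0 \<le> q' y"
  shows "T_stat n x q q' = (\<Sum>i=1..n. root_contrast (q' (x i)) (q (x i)))"
  unfolding T_stat_def using assms by (intro sum.cong psi_dens_ratio) auto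

lemma T_stat_antisym:
  assumes "\<And>y. 0 \<le> q y" "\<And>y. 0 \<le> q' y"
  shows "T_stat n x q' q = - T_stat n x q q'"
  using assms by (simp add: T_stat_eq root_contrast_commute[of "q (x _)"] sum_negf[symmetric])

lemma T_stat_le:
  assumes "\<And>y. 0 \<le> q y" "\<And>y. 0 \<le> q' y"
  shows "\<bar>T_stat n x q q'\<bar> \<le> real n"
proof -
  have "\<bar>T_stat n x q q'\<bar> \<le> (\<Sum>i=1..n. \<bar>root_contrast (q' (x i)) (q (x i))\<bar>)"
    using assms by (simp add: T_stat_eq sum_abs)
  also have "\<dots> \<le> (\<Sum>i=1..n. 1)" by (intro sum_mono root_contrast_abs_le_1 assms)
  finally show ?thesis by simp
qed

section \<open>Uniform deviations by one-sided bracketing\<close>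

text \<open>Chernoff's bound, with \<open>ln E \<le> E - 1\<close> in place of the logarithm of the moment generating
  function.\<close>

lemma chernoff_iid:
  assumes iid: "iid_sample M n X (law p)" and p: "prob_dens p"
    and phi [measurable]: "\<phi> \<in> borel_measurable borel" and bd: "\<And>x. \<bar>\<phi> x\<bar> \<le> (1::real)"
  shows "measure M {\<omega>\<in>space M. real n * ((\<integral>x. p x * exp (\<phi> x / 2) \<partial>lborel) - 1) + t
      \<le> (\<Sum>i=1..n. \<phi> (X i \<omega>) / 2)} \<le> exp (- t)"
proof -
  interpret prob_space M using iid by (simp add: iid_sample_def)
  have ind: "indep_vars (\<lambda>_. borel) X {1..n}" and dX: "\<And>i. i \<in> {1..n} \<Longrightarrow> distr M borel (X i) = law p"
    using iid by (auto simp: iid_sample_def)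
  have X[measurable]: "X i \<in> borel_measurable M" if "i \<in> {1..n}" for i
    using ind that by (auto simp: indep_vars_def)
  have [measurable]: "p \<in> borel_measurable borel" using p by (rule prob_densD)
  define E where "E = (\<integral>x. p x * exp (\<phi> x / 2) \<partial>lborel)"
  define Y where "Y i \<omega> = exp (\<phi> (X i \<omega>) / 2)" for i \<omega>
  have Ym[measurable]: "Y i \<in> borel_measurable M" if "i \<in> {1..n}" for i
    unfolding Y_def using X[OF that] by measurable
  have Yi: "integrable M (Y i)" if i: "i \<in> {1..n}" for i
  proof (rule integrable_const_bound[where B="exp 1"])
    show "AE \<omega> in M. norm (Y i \<omega>) \<le> exp 1"
    proof (rule AE_I2)
      fix \<omega>
      have "\<phi> (X i \<omega>) / 2 \<le> 1" using bd[of "X i \<omega>"] by linarith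
      then show "norm (Y i \<omega>) \<le> exp 1" by (simp add: Y_def)
    qed
  qed (rule Ym[OF i])
  have EY: "(\<integral>\<omega>. Y i \<omega> \<partial>M) = E" if i: "i \<in> {1..n}" for i
  proof -
    have "(\<integral>\<omega>. Y i \<omega> \<partial>M) = (\<integral>x. exp (\<phi> x / 2) \<partial>distr M borel (X i))"
      unfolding Y_def by (rule integral_distr[symmetric]) (use X[OF i] in measurable)
    also have "\<dots> = E"
      unfolding dX[OF i] law_def E_def using prob_densD(2)[OF p]
      by (subst integral_density) auto
    finally show ?thesis .
  qed
  have indY: "indep_vars (\<lambda>_. borel) Y {1..n}"
    unfolding Y_def by (rule indep_vars_compose2[OF ind]) measurable
  define Z where "Z \<omega> = (\<Prod>i=1..n. Y i \<omega>)" for \<omega>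
  have Zi: "integrable M Z" unfolding Z_def
    by (rule indep_vars_integrable) (use indY Yi in auto)
  have EZ: "(\<integral>\<omega>. Z \<omega> \<partial>M) = E ^ n"
    unfolding Z_def by (subst indep_vars_lebesgue_integral) (use indY Yi EY in auto)
  have E0: "0 \<le> E" unfolding E_def using prob_densD(2)[OF p] by (intro Bochner_Integration.integral_nonneg) auto
  have Z0: "0 \<le> Z \<omega>" for \<omega> unfolding Z_def Y_def by (intro prod_nonneg) auto
  define c where "c = exp (real n * (E - 1) + t)"
  have "{\<omega>\<in>space M. real n * (E - 1) + t \<le> (\<Sum>i=1..n. \<phi> (X i \<omega>) / 2)} = {\<omega>\<in>space M. c \<le> Z \<omega>}"
    by (auto simp: c_def Z_def Y_def exp_sum[symmetric])
  moreover have "measure M {\<omega>\<in>space M. c \<le> Z \<omega>} \<le> (\<integral>\<omega>. Z \<omega> \<partial>M) / c"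
    by (rule integral_Markov_inequality_measure[where A="{}"])
       (use Zi Z0 in \<open>auto simp: c_def\<close>)
  moreover have "(\<integral>\<omega>. Z \<omega> \<partial>M) / c \<le> exp (- t)"
  proof -
    have "E \<le> exp (E - 1)" using exp_ge_add_one_self[of "E - 1"] by simp
    then have "E ^ n \<le> exp (E - 1) ^ n" using E0 by (intro power_mono)
    also have "\<dots> = exp (real n * (E - 1))" by (simp add: exp_of_nat_mult)
    finally have "E ^ n / c \<le> exp (real n * (E - 1)) / c" by (intro divide_right_mono) (auto simp: c_def)
    also have "\<dots> = exp (- t)" unfolding c_def exp_diff[symmetric] by simp
    finally show ?thesis by (simp add: EZ)
  qed
  ultimately show ?thesis by (simp add: E_def)
qed

text \<open>The exponential moment of the contrast on one bracket, bounded for every density \<open>q\<close> of the bracket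
  at once: the exceptional set and the change from \<open>p\<close> to \<open>qb\<close> each cost \<open>O(1 / n)\<close>, and off the
  exceptional set the integrand is compared, up to a factor \<open>1 + O(1 / n)\<close>, with
  \<open>(3 * qb + sqrt (q * qb)) / 4\<close>, whose integral is \<open>1 - hell q qb / 4\<close>.\<close>

lemma integral_bracket_le:
  assumes p: "prob_dens p" and qb: "prob_dens qb" and q: "prob_dens q"
    and g [measurable]: "g \<in> borel_measurable borel" and g0: "\<And>x. 0 \<le> g x"
    and J [measurable]: "J \<in> sets borel" and n: "0 < n"
    and pJ: "(\<integral>x. p x * indicator J x \<partial>lborel) \<le> 1 / real n"
    and L1: "(\<integral>x. \<bar>p x - qb x\<bar> \<partial>lborel) \<le> B / real n"
    and br: "\<And>x. x \<notin> J \<Longrightarrow> g x \<le> (1 + 1 / real n)\<^sup>2 * q x"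
  shows "real n * ((\<integral>x. p x * exp ((if x \<in> J then 1 else root_contrast (g x) (qb x)) / 2) \<partial>lborel) - 1)
    \<le> 2 * B + 3 - real n * hell q qb / 4"
proof -
  let ?\<phi> = "\<lambda>x. if x \<in> J then 1 else root_contrast (g x) (qb x)"
  note dp = prob_densD[OF p] and db = prob_densD[OF qb] and dq = prob_densD[OF q]
  note [measurable] = dp(1) db(1) dq(1)
  define e where "e = 1 + 1 / real n"
  have e: "1 \<le> e" by (simp add: e_def)
  let ?R = "\<lambda>x. 2 * (p x * indicator J x) + 2 * \<bar>p x - qb x\<bar> + 3 / 4 * qb x + e / 4 * sqrt (q x * qb x)"
  have phi1: "\<bar>?\<phi> x\<bar> \<le> 1" for x
    using root_contrast_abs_le_1[OF g0[of x] db(2)[of x]] by auto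
  have exp2: "exp (?\<phi> x / 2) \<le> 2" for x
  proof -
    have "exp (?\<phi> x / 2) \<le> exp (1 / 2)" using phi1[of x] by simp
    also have "exp (1 / 2) \<le> (2::real)"
      by (rule order_trans[OF exp_bound]) (auto simp: power2_eq_square)
    finally show ?thesis .
  qed
  have pt: "p x * exp (?\<phi> x / 2) \<le> ?R x" for x
  proof (cases "x \<in> J")
    case True
    have "p x * exp (?\<phi> x / 2) \<le> p x * 2" using exp2[of x] dp(2)[of x] by (rule mult_left_mono)
    moreover have "0 \<le> 3 / 4 * qb x + e / 4 * sqrt (q x * qb x)" using db(2)[of x] dq(2)[of x] e by simp
    moreover have "0 \<le> 2 * \<bar>p x - qb x\<bar>" by simp
    ultimately have "p x * exp (?\<phi> x / 2)
        \<le> p x * 2 + 2 * \<bar>p x - qb x\<bar> + 3 / 4 * qb x + e / 4 * sqrt (q x * qb x)" by linarith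
    then show ?thesis using True by simp
  next
    case False
    have "p x \<le> \<bar>p x - qb x\<bar> + qb x" by linarith
    then have "p x * exp (?\<phi> x / 2) \<le> (\<bar>p x - qb x\<bar> + qb x) * exp (?\<phi> x / 2)"
      by (rule mult_right_mono) simp
    also have "\<dots> = \<bar>p x - qb x\<bar> * exp (?\<phi> x / 2) + qb x * exp (root_contrast (g x) (qb x) / 2)"
      using False by (simp add: algebra_simps)
    also have "\<bar>p x - qb x\<bar> * exp (?\<phi> x / 2) \<le> \<bar>p x - qb x\<bar> * 2"
      using exp2[of x] by (intro mult_left_mono) auto
    also have "qb x * exp (root_contrast (g x) (qb x) / 2) \<le> (3 * qb x + sqrt (g x * qb x)) / 4"
      by (rule exp_root_contrast_le[OF g0 db(2)])
    also have "sqrt (g x * qb x) \<le> e * sqrt (q x * qb x)"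
    proof -
      have "sqrt (g x * qb x) \<le> sqrt (e\<^sup>2 * q x * qb x)"
        using br[OF False] db(2)[of x] by (intro real_sqrt_le_mono mult_right_mono) (auto simp: e_def)
      also have "\<dots> = e * sqrt (q x * qb x)" using e by (simp add: real_sqrt_mult)
      finally show ?thesis .
    qed
    finally have "p x * exp (?\<phi> x / 2) \<le> \<bar>p x - qb x\<bar> * 2 + (3 * qb x + e * sqrt (q x * qb x)) / 4"
      by simp
    then have "p x * exp (?\<phi> x / 2) \<le> 2 * \<bar>p x - qb x\<bar> + 3 / 4 * qb x + e / 4 * sqrt (q x * qb x)"
      by argo
    then show ?thesis using False by simp
  qed
  have iJ: "integrable lborel (\<lambda>x. p x * indicator J x)" using dp(3) by (rule integrable_mult_indicator') simp
  have iL: "integrable lborel (\<lambda>x. \<bar>p x - qb x\<bar>)" using dp(3) db(3) by auto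
  have ia: "integrable lborel (\<lambda>x. sqrt (q x * qb x))" by (rule integrable_affinity[OF q qb])
  have "(\<integral>x. p x * exp (?\<phi> x / 2) \<partial>lborel) \<le> (\<integral>x. ?R x \<partial>lborel)"
  proof (rule integral_mono)
    show "integrable lborel (\<lambda>x. p x * exp (?\<phi> x / 2))"
    proof (rule Bochner_Integration.integrable_bound[where f="\<lambda>x. 2 * p x"])
      show "AE x in lborel. norm (p x * exp (?\<phi> x / 2)) \<le> norm (2 * p x)"
      proof (rule AE_I2)
        fix x
        have "p x * exp (?\<phi> x / 2) \<le> p x * 2" using exp2[of x] dp(2)[of x] by (rule mult_left_mono)
        then show "norm (p x * exp (?\<phi> x / 2)) \<le> norm (2 * p x)" using dp(2)[of x] by (simp add: abs_mult)
      qed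
    qed (use dp in \<open>auto intro!: integrable_mult_right\<close>)
    show "integrable lborel ?R" using iJ iL ia db(3) by auto
  qed (rule pt)
  also have "\<dots> = 2 * (\<integral>x. p x * indicator J x \<partial>lborel) + 2 * (\<integral>x. \<bar>p x - qb x\<bar> \<partial>lborel) + 3 / 4
      + e / 4 * (1 - hell q qb)"
    using iJ iL ia db(3,4) integral_affinity[OF q qb] by simp
  finally have int: "(\<integral>x. p x * exp (?\<phi> x / 2) \<partial>lborel) \<le> 2 * (\<integral>x. p x * indicator J x \<partial>lborel)
      + 2 * (\<integral>x. \<bar>p x - qb x\<bar> \<partial>lborel) + 3 / 4 + e / 4 * (1 - hell q qb)" .
  have "e / 4 * (1 - hell q qb) \<le> (1 - hell q qb) / 4 + 1 / (4 * real n)"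
    using hell_nonneg[of q qb] n by (simp add: e_def field_simps)
  with int pJ L1 have "(\<integral>x. p x * exp (?\<phi> x / 2) \<partial>lborel) - 1 \<le> 2 / real n + 2 * (B / real n) + 1 / (4 * real n) - hell q qb / 4"
    by argo
  then have "real n * ((\<integral>x. p x * exp (?\<phi> x / 2) \<partial>lborel) - 1)
      \<le> real n * (2 / real n + 2 * (B / real n) + 1 / (4 * real n) - hell q qb / 4)"
    by (rule mult_left_mono) simp
  also have "\<dots> = 2 + 2 * B + 1 / 4 - real n * hell q qb / 4" using n by (simp add: field_simps)
  finally show ?thesis by simp
qed

text \<open>Since the contrast is bounded by one and increasing in its first argument, only upper brackets
  \<open>g k\<close> are needed, and \<open>g k\<close> may fail to dominate on an exceptional set \<open>J k\<close> of probability at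
  most \<open>1 / n\<close>, where the contrast is simply replaced by one.  This is what makes moving infinite
  peaks harmless.\<close>

definition bracketing ::
  "nat \<Rightarrow> (real \<Rightarrow> real) \<Rightarrow> (real \<Rightarrow> real) set \<Rightarrow> 'k set \<Rightarrow> ('k \<Rightarrow> real \<Rightarrow> real) \<Rightarrow> ('k \<Rightarrow> real set) \<Rightarrow> bool"
  where "bracketing n p Q K g J \<longleftrightarrow> finite K \<and>
    (\<forall>k\<in>K. g k \<in> borel_measurable borel \<and> (\<forall>x. 0 \<le> g k x) \<and> J k \<in> sets borel \<and>
       (\<integral>x. p x * indicator (J k) x \<partial>lborel) \<le> 1 / real n) \<and>
    (\<forall>q\<in>Q. \<exists>k\<in>K. \<forall>x. x \<notin> J k \<longrightarrow> q x \<le> g k x \<and> g k x \<le> (1 + 1 / real n)\<^sup>2 * q x)"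

text \<open>Chernoff's bound for each bracket and a union bound over the brackets give the rate
  \<open>(ln N + \<xi>) / n\<close> uniformly over the class.  The exponential moments are computed under \<open>qb\<close> instead
  of \<open>p\<close>, at the price of the \<open>L1\<close> distance between the two.\<close>

lemma uniform_T_stat_bound:
  assumes iid: "iid_sample M n X (law p)" and p: "prob_dens p" and qb: "prob_dens qb" and n: "0 < n"
    and Q: "\<And>q. q \<in> Q \<Longrightarrow> prob_dens q"
    and br: "bracketing n p Q K g J" and card: "real (card K) \<le> N" and N: "0 < N"
    and L1: "(\<integral>x. \<bar>p x - qb x\<bar> \<partial>lborel) \<le> B / real n"
  shows "with_prob_at_least M (1 - exp (- \<xi>)) (\<lambda>\<omega>. \<forall>q\<in>Q.
      T_stat n (\<lambda>i\<in>{1..n}. X i \<omega>) qb q \<le> 2 * (2 * B + 3 + ln N + \<xi>) - real n * hell q qb / 2)"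
proof -
  interpret prob_space M using iid by (simp add: iid_sample_def)
  have X[measurable]: "X i \<in> borel_measurable M" if "i \<in> {1..n}" for i
    using iid that by (auto simp: iid_sample_def indep_vars_def)
  note K = br[unfolded bracketing_def, THEN conjunct1] card N
  have g: "g k \<in> borel_measurable borel" and g0: "0 \<le> g k x" and J: "J k \<in> sets borel"
    and pJ: "(\<integral>x. p x * indicator (J k) x \<partial>lborel) \<le> 1 / real n" if "k \<in> K" for k x
    using br that by (auto simp: bracketing_def)
  note db = prob_densD[OF qb]
  note [measurable] = db(1)
  define \<phi> where "\<phi> k x = (if x \<in> J k then 1 else root_contrast (g k x) (qb x))" for k x
  have phim[measurable]: "\<phi> k \<in> borel_measurable borel" if "k \<in> K" for k
    unfolding \<phi>_def using g[OF that] J[OF that] by measurable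
  have phi1: "\<bar>\<phi> k x\<bar> \<le> 1" if "k \<in> K" for k x
    using root_contrast_abs_le_1[OF g0[OF that, of x] db(2)[of x]] by (auto simp: \<phi>_def)
  define E where "E k = (\<integral>x. p x * exp (\<phi> k x / 2) \<partial>lborel)" for k
  define bad where "bad k = {\<omega>\<in>space M. real n * (E k - 1) + (ln N + \<xi>) \<le> (\<Sum>i=1..n. \<phi> k (X i \<omega>) / 2)}" for k
  have badm: "bad k \<in> sets M" if "k \<in> K" for k
  proof -
    have [measurable]: "(\<lambda>\<omega>. \<phi> k (X i \<omega>)) \<in> borel_measurable M" if "i \<in> {1..n}" for i
      using X[OF that] phim[OF \<open>k \<in> K\<close>] by measurable
    show ?thesis unfolding bad_def by measurable
  qed
  have "measure M (\<Union>k\<in>K. bad k) \<le> (\<Sum>k\<in>K. measure M (bad k))"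
    by (rule finite_measure_subadditive_finite) (use K badm in auto)
  also have "\<dots> \<le> (\<Sum>k\<in>K. exp (- (ln N + \<xi>)))"
    unfolding bad_def E_def by (intro sum_mono chernoff_iid iid p phim phi1)
  also have "\<dots> = real (card K) * exp (- \<xi>) / N" using K by (simp add: exp_diff exp_minus field_simps)
  also have "\<dots> \<le> exp (- \<xi>)" using K by (simp add: field_simps mult_right_mono)
  finally have bad: "measure M (\<Union>k\<in>K. bad k) \<le> exp (- \<xi>)" .
  have Um: "(\<Union>k\<in>K. bad k) \<in> sets M" using K badm by auto
  define A where "A = space M - (\<Union>k\<in>K. bad k)"
  have "A \<in> sets M" unfolding A_def using Um by auto
  moreover have "1 - exp (- \<xi>) \<le> measure M A"
    unfolding A_def using bad prob_compl[OF Um] by simp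
  moreover have "T_stat n (\<lambda>i\<in>{1..n}. X i \<omega>) qb q \<le> 2 * (2 * B + 3 + ln N + \<xi>) - real n * hell q qb / 2"
    if w: "\<omega> \<in> A" and q: "q \<in> Q" for \<omega> q
  proof -
    obtain k where k: "k \<in> K" and le: "\<And>x. x \<notin> J k \<Longrightarrow> q x \<le> g k x"
      and ge: "\<And>x. x \<notin> J k \<Longrightarrow> g k x \<le> (1 + 1 / real n)\<^sup>2 * q x"
      using br q unfolding bracketing_def by blast
    note dq = prob_densD[OF Q[OF q]]
    have "T_stat n (\<lambda>i\<in>{1..n}. X i \<omega>) qb q = (\<Sum>i=1..n. root_contrast (q (X i \<omega>)) (qb (X i \<omega>)))"
      using db(2) dq(2) by (subst T_stat_eq) auto
    also have "\<dots> \<le> (\<Sum>i=1..n. \<phi> k (X i \<omega>))"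
    proof (rule sum_mono)
      fix i
      let ?y = "X i \<omega>"
      have "root_contrast (q ?y) (qb ?y) \<le> 1"
        using root_contrast_abs_le_1[OF dq(2)[of ?y] db(2)[of ?y]] by simp
      then show "root_contrast (q ?y) (qb ?y) \<le> \<phi> k ?y"
        using root_contrast_mono[OF dq(2)[of ?y] le db(2)[of ?y]] by (simp add: \<phi>_def)
    qed
    also have "\<dots> = 2 * (\<Sum>i=1..n. \<phi> k (X i \<omega>) / 2)" by (simp add: sum_divide_distrib[symmetric])
    also have "(\<Sum>i=1..n. \<phi> k (X i \<omega>) / 2) \<le> real n * (E k - 1) + (ln N + \<xi>)"
      using w k by (force simp: A_def bad_def)
    also have "real n * (E k - 1) \<le> 2 * B + 3 - real n * hell q qb / 4"
      unfolding E_def \<phi>_def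
      by (rule integral_bracket_le[OF p qb Q[OF q] g[OF k] g0[OF k] J[OF k] n pJ[OF k] L1 ge])
    finally show ?thesis by simp
  qed
  then have "A \<subseteq> {\<omega>\<in>space M. \<forall>q\<in>Q. T_stat n (\<lambda>i\<in>{1..n}. X i \<omega>) qb q
      \<le> 2 * (2 * B + 3 + ln N + \<xi>) - real n * hell q qb / 2}"
    by (auto simp: A_def)
  ultimately show ?thesis unfolding with_prob_at_least_def by blast
qed

text \<open>By antisymmetry of the statistic, a near-minimiser \<open>q\<close> of its supremum satisfies
  \<open>- T qb q = T q qb \<le> Upsilon qb + 8.24\<close>, and the uniform bound, applied once inside \<open>Upsilon qb\<close> and
  once to \<open>T qb q\<close>, leaves only the Hellinger distance between \<open>q\<close> and \<open>qb\<close>.\<close>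

lemma near_minimizer_hell_le:
  assumes n: "0 < n" and qb: "qb \<in> Q" and q: "q \<in> Q"
    and nonneg: "\<And>f y. f \<in> Q \<Longrightarrow> 0 \<le> f y"
    and T: "\<And>f. f \<in> Q \<Longrightarrow> T_stat n x qb f \<le> 2 * L - real n * hell f qb / 2"
    and min: "Upsilon Q n x q < (INF f\<in>Q. Upsilon Q n x f) + 8.24"
  shows "hell q qb \<le> (8 * L + 16.48) / real n"
proof -
  have Tn: "\<bar>T_stat n x f f'\<bar> \<le> real n" if "f \<in> Q" "f' \<in> Q" for f f'
    using that nonneg by (intro T_stat_le) auto
  have bdd: "bdd_above ((\<lambda>f'. T_stat n x f f') ` Q)" if "f \<in> Q" for f
    using Tn[OF that] by (intro bdd_aboveI2[where M="real n"]) (auto simp: abs_le_iff)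
  have U: "T_stat n x f f' \<le> Upsilon Q n x f" if "f \<in> Q" "f' \<in> Q" for f f'
    unfolding Upsilon_def using that bdd by (intro cSUP_upper) auto
  have "bdd_below ((\<lambda>f. Upsilon Q n x f) ` Q)"
  proof (rule bdd_belowI2[where m="- real n"])
    fix f assume f: "f \<in> Q"
    show "- real n \<le> Upsilon Q n x f" using U[OF f f] Tn[OF f f] by linarith
  qed
  then have "(INF f\<in>Q. Upsilon Q n x f) \<le> Upsilon Q n x qb" using qb by (intro cINF_lower) auto
  moreover have "Upsilon Q n x qb \<le> 2 * L"
    unfolding Upsilon_def
  proof (rule cSUP_least)
    show "Q \<noteq> {}" using qb by auto
    fix f assume "f \<in> Q"
    then show "T_stat n x qb f \<le> 2 * L"
      using T[of f] mult_nonneg_nonneg[OF of_nat_0_le_iff hell_nonneg, of n f qb] by linarith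
  qed
  moreover have "T_stat n x q qb \<le> Upsilon Q n x q" by (rule U[OF q qb])
  moreover have "T_stat n x q qb = - T_stat n x qb q" using nonneg q qb by (intro T_stat_antisym) auto
  ultimately have "real n * hell q qb / 2 \<le> 4 * L + 8.24" using min T[OF q] by linarith
  then have "real n * hell q qb \<le> 8 * L + 16.48" by simp
  then show ?thesis using n by (simp add: field_simps)
qed

text \<open>The estimate is a limit of near-minimisers; one within squared distance \<open>1 / n\<close> is enough, and
  the triangle inequality leads through it and \<open>qb\<close> to \<open>p\<close>.\<close>

lemma rho_estimate_hell_le:
  assumes n: "0 < n" and p: "prob_dens p" and f: "prob_dens f"
    and qb: "qb \<in> Q" and Q: "\<And>q. q \<in> Q \<Longrightarrow> prob_dens q"
    and L1: "(\<integral>x. \<bar>p x - qb x\<bar> \<partial>lborel) \<le> B / real n"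
    and T: "\<And>q. q \<in> Q \<Longrightarrow> T_stat n x qb q \<le> 2 * L - real n * hell q qb / 2"
    and cl: "law f \<in> hellinger_closure (near_minimizers Q n x)"
  shows "hell p f \<le> (32 * L + 68 + 2 * B) / real n"
proof -
  have "0 < sqrt (1 / real n)" using n by simp
  then obtain P where P: "P \<in> near_minimizers Q n x" "hellinger lborel (law f) P < sqrt (1 / real n)"
    using cl unfolding hellinger_closure_def by blast
  then obtain q where q: "q \<in> Q" "P = law q"
    and min: "Upsilon Q n x q < (INF f\<in>Q. Upsilon Q n x f) + 8.24"
    unfolding near_minimizers_def by blast
  note dq = Q[OF q(1)] and db = Q[OF qb]
  have "hell f q \<le> 1 / real n"
    using P(2) hellinger_sq_law[OF f dq] by (simp add: hellinger_def q(2) real_sqrt_less_iff)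
  moreover have "hell q qb \<le> (8 * L + 16.48) / real n"
    by (rule near_minimizer_hell_le[OF n qb q(1) _ T min]) (use Q prob_densD(2) in blast)+
  moreover have "hell p qb \<le> 1 / 2 * (B / real n)" using hell_le_L1[OF p db] L1 by linarith
  moreover have "hell p f \<le> 2 * hell f q + 2 * hell q p"
    using hell_triangle[OF f dq p] by (simp add: hell_commute)
  moreover have "hell q p \<le> 2 * hell q qb + 2 * hell p qb"
    using hell_triangle[OF dq db p] by (simp add: hell_commute)
  ultimately have "hell p f \<le> 2 * (1 / real n) + 4 * ((8 * L + 16.48) / real n) + 4 * (1 / 2 * (B / real n))"
    by linarith
  also have "\<dots> \<le> (32 * L + 68 + 2 * B) / real n" using n by (simp add: field_simps)
  finally show ?thesis .
qed

section \<open>Brackets for the mixture model\<close>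

text \<open>Away from the two kinds of critical points of the kernel, its singularity and the endpoints of
  its support, a shift by much less than the distance to them changes the kernel by a factor close
  to one.\<close>

lemma s_dens_shift_ratio:
  assumes a: "0 < \<alpha>" "\<alpha> < 1" and r: "0 < r" and e: "0 < \<epsilon>" "\<epsilon> < 1"
    and zw: "\<bar>z - w\<bar> \<le> \<epsilon> * r" and x: "r < \<bar>x - w\<bar>" "r < \<bar>\<bar>x - w\<bar> - 1\<bar>"
  shows "s_dens \<alpha> (x - z) \<le> s_dens \<alpha> (x - w) / (1 - \<epsilon>)"
    and "s_dens \<alpha> (x - w) \<le> (1 + \<epsilon>) * s_dens \<alpha> (x - z)"
proof -
  define A B where "A = \<bar>x - w\<bar>" and "B = \<bar>x - z\<bar>"
  have er: "\<epsilon> * r \<le> r" using r e by simp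
  have eA: "\<epsilon> * r \<le> \<epsilon> * A" using x e by (simp add: A_def)
  have AB: "\<bar>A - B\<bar> \<le> \<epsilon> * r" using zw by (simp add: A_def B_def)
  have A0: "0 < A" using x r by (simp add: A_def)
  have B1: "(1 - \<epsilon>) * A \<le> B" using AB eA by (simp add: algebra_simps)
  have B2: "B \<le> (1 + \<epsilon>) * A" using AB eA by (simp add: algebra_simps)
  have B0: "0 < B" using B1 A0 e by (metis diff_gt_0_iff_gt less_le_trans mult_pos_pos)
  have "s_dens \<alpha> (x - z) \<le> s_dens \<alpha> (x - w) / (1 - \<epsilon>) \<and> s_dens \<alpha> (x - w) \<le> (1 + \<epsilon>) * s_dens \<alpha> (x - z)"
  proof (cases "A \<le> 1")
    case True
    then have "A + r < 1" using x by (simp add: A_def)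
    then have Ble: "B \<le> 1" using AB er by linarith
    have sA: "s_dens \<alpha> (x - w) = (1 - \<alpha>) / 2 * A powr (- \<alpha>)"
      unfolding A_def by (rule s_dens_eq) (use A0 True in \<open>auto simp: A_def\<close>)
    have sB: "s_dens \<alpha> (x - z) = (1 - \<alpha>) / 2 * B powr (- \<alpha>)"
      unfolding B_def by (rule s_dens_eq) (use B0 Ble in \<open>auto simp: B_def\<close>)
    have "B powr (- \<alpha>) \<le> ((1 - \<epsilon>) * A) powr (- \<alpha>)"
      by (rule powr_mono2') (use a e A0 B1 in auto)
    also have "\<dots> = (1 - \<epsilon>) powr (- \<alpha>) * A powr (- \<alpha>)" using e A0 by (simp add: powr_mult)
    also have "(1 - \<epsilon>) powr (- \<alpha>) \<le> (1 - \<epsilon>) powr (- 1)"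
      by (rule powr_mono') (use a e in auto)
    also have "(1 - \<epsilon>) powr (- 1) = 1 / (1 - \<epsilon>)" using e by (simp add: powr_minus divide_inverse)
    finally have 1: "B powr (- \<alpha>) \<le> A powr (- \<alpha>) / (1 - \<epsilon>)" by (simp add: mult_right_mono)
    have "((1 + \<epsilon>) * A) powr (- \<alpha>) \<le> B powr (- \<alpha>)"
      by (rule powr_mono2') (use a e A0 B0 B2 in auto)
    then have "(1 + \<epsilon>) powr (- \<alpha>) * A powr (- \<alpha>) \<le> B powr (- \<alpha>)" using e A0 by (simp add: powr_mult)
    then have "(1 + \<epsilon>) powr \<alpha> * ((1 + \<epsilon>) powr (- \<alpha>) * A powr (- \<alpha>)) \<le> (1 + \<epsilon>) powr \<alpha> * B powr (- \<alpha>)"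
      by (rule mult_left_mono) simp
    moreover have "(1 + \<epsilon>) powr \<alpha> * (1 + \<epsilon>) powr (- \<alpha>) = 1" using e by (simp add: powr_minus)
    ultimately have "A powr (- \<alpha>) \<le> (1 + \<epsilon>) powr \<alpha> * B powr (- \<alpha>)"
      by (simp add: mult.assoc[symmetric])
    also have "(1 + \<epsilon>) powr \<alpha> \<le> (1 + \<epsilon>) powr 1"
      by (rule powr_mono) (use a e in auto)
    finally have 2: "A powr (- \<alpha>) \<le> (1 + \<epsilon>) * B powr (- \<alpha>)" using e by (simp add: mult_right_mono)
    show ?thesis
      using mult_left_mono[OF 1, of "(1 - \<alpha>) / 2"] mult_left_mono[OF 2, of "(1 - \<alpha>) / 2"] a
      by (simp add: sA sB mult.left_commute)
  next
    case False
    then have "1 < A - r" using x by (simp add: A_def)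
    then have "1 < B" using AB er by linarith
    then have "s_dens \<alpha> (x - z) = 0" by (intro s_dens_outside) (simp add: B_def)
    moreover have "s_dens \<alpha> (x - w) = 0" using False by (intro s_dens_outside) (simp add: A_def)
    ultimately show ?thesis by simp
  qed
  then show "s_dens \<alpha> (x - z) \<le> s_dens \<alpha> (x - w) / (1 - \<epsilon>)"
    and "s_dens \<alpha> (x - w) \<le> (1 + \<epsilon>) * s_dens \<alpha> (x - z)" by auto
qed

lemma mix_dens_ratio:
  assumes a: "0 < \<alpha>" "\<alpha> < 1" and r: "0 < r" and e: "0 < \<epsilon>" "\<epsilon> < 1"
    and zw: "\<bar>z - w\<bar> \<le> \<epsilon> * r" and x: "r < \<bar>x - w\<bar>" "r < \<bar>\<bar>x - w\<bar> - 1\<bar>"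
    and l: "0 \<le> l" "l \<le> lam" "lam \<le> 1" "(1 - \<epsilon>) * lam \<le> l" "1 - l \<le> (1 + \<epsilon>) * (1 - lam)"
  shows "mix_dens \<alpha> lam z x \<le> mix_dens \<alpha> l w x / (1 - \<epsilon>)\<^sup>2"
    and "mix_dens \<alpha> l w x / (1 - \<epsilon>)\<^sup>2 \<le> ((1 + \<epsilon>) / (1 - \<epsilon>))\<^sup>2 * mix_dens \<alpha> lam z x"
proof -
  note rat = s_dens_shift_ratio[OF a r e zw x]
  note nn = s_dens_nonneg[OF a(2)]
  have e1: "0 < 1 - \<epsilon>" "(1 - \<epsilon>)\<^sup>2 \<le> 1" using e by (auto intro!: power_le_one)
  have "(1 - lam) * s_dens \<alpha> x * (1 - \<epsilon>)\<^sup>2 \<le> (1 - l) * s_dens \<alpha> x * 1"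
    using l e1 nn[of x] by (intro mult_mono) auto
  moreover have "lam * s_dens \<alpha> (x - z) * (1 - \<epsilon>)\<^sup>2 \<le> l * s_dens \<alpha> (x - w)"
  proof -
    have "s_dens \<alpha> (x - z) * (1 - \<epsilon>) \<le> s_dens \<alpha> (x - w)" using rat(1) e1 by (simp add: field_simps)
    then have "((1 - \<epsilon>) * lam) * (s_dens \<alpha> (x - z) * (1 - \<epsilon>)) \<le> l * s_dens \<alpha> (x - w)"
      using l e1 nn[of "x - z"] by (intro mult_mono) auto
    then show ?thesis by (simp add: power2_eq_square mult_ac)
  qed
  ultimately have "mix_dens \<alpha> lam z x * (1 - \<epsilon>)\<^sup>2 \<le> mix_dens \<alpha> l w x"
    by (simp add: mix_dens_def distrib_right)
  then show "mix_dens \<alpha> lam z x \<le> mix_dens \<alpha> l w x / (1 - \<epsilon>)\<^sup>2" using e1 by (simp add: field_simps)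
  have "(1 - l) * s_dens \<alpha> x \<le> (1 + \<epsilon>) * (1 - lam) * s_dens \<alpha> x"
    using l nn[of x] by (intro mult_right_mono) auto
  moreover have "l * s_dens \<alpha> (x - w) \<le> lam * ((1 + \<epsilon>) * s_dens \<alpha> (x - z))"
    using l rat(2) nn[of "x - w"] by (intro mult_mono) auto
  ultimately have "mix_dens \<alpha> l w x \<le> (1 + \<epsilon>) * mix_dens \<alpha> lam z x"
    by (simp add: mix_dens_def algebra_simps)
  also have "\<dots> \<le> (1 + \<epsilon>)\<^sup>2 * mix_dens \<alpha> lam z x"
    using e l nn by (intro mult_right_mono) (auto simp: power2_eq_square mix_dens_def)
  finally have "mix_dens \<alpha> l w x / (1 - \<epsilon>)\<^sup>2 \<le> (1 + \<epsilon>)\<^sup>2 * mix_dens \<alpha> lam z x / (1 - \<epsilon>)\<^sup>2"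
    by (rule divide_right_mono) simp
  then show "mix_dens \<alpha> l w x / (1 - \<epsilon>)\<^sup>2 \<le> ((1 + \<epsilon>) / (1 - \<epsilon>))\<^sup>2 * mix_dens \<alpha> lam z x"
    by (simp add: power_divide)
qed

text \<open>The exceptional set of a bracket centred at shift \<open>w\<close>.  Adding the zeros of \<open>p\<close> costs no mass and
  lets the brackets ignore what happens off the support of the true distribution.\<close>

lemma critical_set_mass:
  fixes zs :: real
  assumes a: "0 < \<alpha>" "\<alpha> < 1" and l: "0 \<le> ls" "ls \<le> 1" and r: "0 < r" "r \<le> 1"
  defines "p \<equiv> mix_dens \<alpha> ls zs"
  shows "(\<integral>x. p x * indicator {x. \<bar>x - w\<bar> \<le> r \<or> \<bar>\<bar>x - w\<bar> - 1\<bar> \<le> r \<or> p x = 0} x \<partial>lborel)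
    \<le> 6 * r powr (1 - \<alpha>)"
proof -
  have p: "prob_dens p" unfolding p_def using a l by (intro prob_dens_mix)
  note dp = prob_densD[OF p]
  note [measurable] = dp(1)
  let ?I = "\<lambda>c x. p x * indicator {c-r..c+r} x"
  have int: "integrable lborel (?I c)" for c using dp(3) by (rule integrable_mult_indicator') simp
  have "(\<integral>x. p x * indicator {x. \<bar>x - w\<bar> \<le> r \<or> \<bar>\<bar>x - w\<bar> - 1\<bar> \<le> r \<or> p x = 0} x \<partial>lborel)
      \<le> (\<integral>x. ?I w x + ?I (w + 1) x + ?I (w - 1) x \<partial>lborel)"
  proof (rule integral_mono)
    show "integrable lborel (\<lambda>x. p x * indicator {x. \<bar>x - w\<bar> \<le> r \<or> \<bar>\<bar>x - w\<bar> - 1\<bar> \<le> r \<or> p x = 0} x)"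
      using dp(3) by (rule integrable_mult_indicator') measurable
    show "integrable lborel (\<lambda>x. ?I w x + ?I (w + 1) x + ?I (w - 1) x)" using int by auto
    fix x
    have nn: "0 \<le> ?I c x" for c using dp(2)[of x] by simp
    show "p x * indicator {x. \<bar>x - w\<bar> \<le> r \<or> \<bar>\<bar>x - w\<bar> - 1\<bar> \<le> r \<or> p x = 0} x
        \<le> ?I w x + ?I (w + 1) x + ?I (w - 1) x"
    proof (cases "\<bar>x - w\<bar> \<le> r \<or> \<bar>\<bar>x - w\<bar> - 1\<bar> \<le> r")
      case True
      then consider "x \<in> {w-r..w+r}" | "x \<in> {w+1-r..w+1+r}" | "x \<in> {w-1-r..w-1+r}"
        by (auto simp: abs_if split: if_splits)
      then have "p x \<le> ?I w x + ?I (w + 1) x + ?I (w - 1) x"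
        using nn[of w] nn[of "w + 1"] nn[of "w - 1"] by cases simp_all
      moreover have "p x * indicator {x. \<bar>x - w\<bar> \<le> r \<or> \<bar>\<bar>x - w\<bar> - 1\<bar> \<le> r \<or> p x = 0} x \<le> p x"
        using dp(2)[of x] by (simp add: indicator_def)
      ultimately show ?thesis by linarith
    next
      case False
      then have "p x * indicator {x. \<bar>x - w\<bar> \<le> r \<or> \<bar>\<bar>x - w\<bar> - 1\<bar> \<le> r \<or> p x = 0} x = 0"
        by (simp add: indicator_def)
      then show ?thesis using nn[of w] nn[of "w + 1"] nn[of "w - 1"] by linarith
    qed
  qed
  also have "\<dots> = (\<integral>x. ?I w x \<partial>lborel) + (\<integral>x. ?I (w + 1) x \<partial>lborel) + (\<integral>x. ?I (w - 1) x \<partial>lborel)"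
    using int by simp
  also have "\<dots> \<le> 2 * r powr (1 - \<alpha>) + 2 * r powr (1 - \<alpha>) + 2 * r powr (1 - \<alpha>)"
    unfolding p_def by (intro add_mono mix_dens_interval_mass a r l)
  finally show ?thesis by simp
qed

text \<open>Shifts beyond the truncation level move the second component off the support of the true
  distribution, where all of them look alike.\<close>

lemma mix_dens_truncate_shift:
  assumes px: "mix_dens \<alpha> ls zs x \<noteq> 0" and R: "\<bar>zs\<bar> + 3 \<le> R"
  shows "mix_dens \<alpha> lam (max (- R) (min R z)) x = mix_dens \<alpha> lam z x"
proof (cases "\<bar>z\<bar> \<le> R")
  case True
  then have "max (- R) (min R z) = z" by auto
  then show ?thesis by simp
next
  case False
  have "\<bar>x\<bar> \<le> 1 \<or> \<bar>x - zs\<bar> \<le> 1"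
    using px s_dens_outside[of x \<alpha>] s_dens_outside[of "x - zs" \<alpha>] by (force simp: mix_dens_def)
  then have "\<bar>x\<bar> \<le> \<bar>zs\<bar> + 1" by linarith
  moreover have "\<bar>max (- R) (min R z)\<bar> \<ge> R" using False R by auto
  ultimately have "1 < \<bar>x - z\<bar>" "1 < \<bar>x - max (- R) (min R z)\<bar>" using False R by linarith+
  then show ?thesis by (simp add: mix_dens_def s_dens_outside)
qed

text \<open>Weights and truncated shifts are rounded down to grids of mesh \<open>1 / n\<^sup>2\<close> and \<open>r / (4 n)\<close>.  The
  radius \<open>r\<close> of the critical set is such that this set has probability at most \<open>1 / n\<close>.  The weights of
  the model stay away from zero and one by at least \<open>10 / n\<close>, so that rounding changes both component
  weights by a factor close to one.  The number of brackets is polynomial in \<open>n\<close>.\<close>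

lemma model_brackets:
  fixes n :: nat and zs :: real
  assumes a: "0 < \<alpha>" "\<alpha> < 1" and ls: "0 \<le> ls" "ls \<le> 1" and n: "20 \<le> n"
  defines "p \<equiv> mix_dens \<alpha> ls zs"
  obtains K :: "(int \<times> int) set" and g J where "bracketing n p (model_dens \<alpha> D (10 / real n)) K g J"
    "real (card K) \<le> (8 * \<bar>zs\<bar> + 26) * 2 * real n ^ 3 * real n powr (2 / (1 - \<alpha>))"
proof -
  define m where "m = (real n)\<^sup>2"
  define \<epsilon> where "\<epsilon> = 1 / (4 * real n)"
  define r where "r = (1 / (6 * real n)) powr (1 / (1 - \<alpha>))"
  define \<eta> where "\<eta> = \<epsilon> * r"
  define R where "R = \<bar>zs\<bar> + 3"
  define K :: "(int \<times> int) set" where "K = {0..int n ^ 2} \<times> {\<lfloor>- R / \<eta>\<rfloor>..\<lfloor>R / \<eta>\<rfloor>}"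
  define g where "g k x = mix_dens \<alpha> (real_of_int (fst k) / m) (\<eta> * real_of_int (snd k)) x / (1 - \<epsilon>)\<^sup>2"
    for k :: "int \<times> int" and x
  define J where "J k = {x. \<bar>x - \<eta> * real_of_int (snd k)\<bar> \<le> r \<or> \<bar>\<bar>x - \<eta> * real_of_int (snd k)\<bar> - 1\<bar> \<le> r \<or> p x = 0}"
    for k :: "int \<times> int"
  have p: "prob_dens p" unfolding p_def using a ls by (intro prob_dens_mix)
  note [measurable] = prob_densD(1)[OF p]
  have n0: "20 \<le> real n" using n by simp
  have m: "0 < m" using n0 by (simp add: m_def)
  have e: "0 < \<epsilon>" "\<epsilon> < 1" "\<epsilon> \<le> 1 / 2" using n0 by (auto simp: \<epsilon>_def field_simps)
  have r: "0 < r" "r \<le> 1" using n0 a by (auto simp: r_def intro!: powr_le1)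
  have ra: "r powr (1 - \<alpha>) = 1 / (6 * real n)" using n0 a by (simp add: r_def powr_powr)
  have h: "0 < \<eta>" using e r by (simp add: \<eta>_def)
  have R: "3 \<le> R" by (simp add: R_def)
  have wt: "0 \<le> real_of_int (fst k) / m" "real_of_int (fst k) / m \<le> 1" if "k \<in> K" for k
  proof -
    have "0 \<le> fst k" "fst k \<le> int n ^ 2" using that by (auto simp: K_def)
    then have "0 \<le> real_of_int (fst k)" "real_of_int (fst k) \<le> real_of_int (int n ^ 2)"
      by (simp_all only: of_int_le_iff of_int_0_le_iff)
    then show "0 \<le> real_of_int (fst k) / m" "real_of_int (fst k) / m \<le> 1"
      using m by (simp_all add: m_def)
  qed
  have "finite K" by (simp add: K_def)
  moreover have "real (card K) \<le> (8 * \<bar>zs\<bar> + 26) * 2 * real n ^ 3 * real n powr (2 / (1 - \<alpha>))"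
  proof -
    have "- R / \<eta> \<le> R / \<eta>" using R h by (intro divide_right_mono) auto
    then have le: "\<lfloor>- R / \<eta>\<rfloor> \<le> \<lfloor>R / \<eta>\<rfloor>" by (rule floor_mono)
    have "real (card K) = real_of_int (int n ^ 2 + 1) * real_of_int (\<lfloor>R / \<eta>\<rfloor> - \<lfloor>- R / \<eta>\<rfloor> + 1)"
      using le by (simp add: K_def card_cartesian_product nat_add_distrib of_nat_nat) (simp add: algebra_simps)
    also have "\<dots> \<le> (2 * (real n)\<^sup>2) * (2 * (R / \<eta>) + 2)"
    proof (rule mult_mono)
      show "real_of_int (int n ^ 2 + 1) \<le> 2 * (real n)\<^sup>2" using n0 by simp
      have "real_of_int \<lfloor>R / \<eta>\<rfloor> \<le> R / \<eta>" "- R / \<eta> < real_of_int \<lfloor>- R / \<eta>\<rfloor> + 1" by linarith+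
      moreover have "- R / \<eta> = - (R / \<eta>)" by simp
      ultimately show "real_of_int (\<lfloor>R / \<eta>\<rfloor> - \<lfloor>- R / \<eta>\<rfloor> + 1) \<le> 2 * (R / \<eta>) + 2"
        unfolding of_int_add of_int_diff of_int_1 by linarith
      show "0 \<le> real_of_int (\<lfloor>R / \<eta>\<rfloor> - \<lfloor>- R / \<eta>\<rfloor> + 1)" using le by simp
    qed simp
    also have "2 * (R / \<eta>) + 2 \<le> (8 * R + 2) * (real n * real n powr (2 / (1 - \<alpha>)))"
    proof -
      have "(6 * real n) powr (1 / (1 - \<alpha>)) \<le> (real n powr 2) powr (1 / (1 - \<alpha>))"
        using n0 a by (intro powr_mono2) (auto simp: power2_eq_square)
      then have P: "(6 * real n) powr (1 / (1 - \<alpha>)) \<le> real n powr (2 / (1 - \<alpha>))"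
        unfolding powr_powr by simp
      have eta: "1 / \<eta> = 4 * real n * (6 * real n) powr (1 / (1 - \<alpha>))"
        using n0 by (simp add: \<eta>_def \<epsilon>_def r_def powr_divide)
      have one: "1 \<le> real n * real n powr (2 / (1 - \<alpha>))"
      proof -
        have "1 \<le> real n powr (2 / (1 - \<alpha>))" using n0 a by (intro ge_one_powr_ge_zero) auto
        then have "1 * 1 \<le> real n * real n powr (2 / (1 - \<alpha>))" using n0 by (intro mult_mono) auto
        then show ?thesis by simp
      qed
      have "2 * (R / \<eta>) = 8 * R * (real n * (6 * real n) powr (1 / (1 - \<alpha>)))"
        using eta by (simp add: divide_inverse)
      also have "\<dots> \<le> 8 * R * (real n * real n powr (2 / (1 - \<alpha>)))"
        using P R by (intro mult_left_mono) auto
      finally show ?thesis using one by (simp add: distrib_right)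
    qed
    finally have "real (card K) \<le> 2 * (real n)\<^sup>2 * ((8 * R + 2) * (real n * real n powr (2 / (1 - \<alpha>))))"
      by (simp add: mult_left_mono)
    also have "\<dots> = (8 * R + 2) * 2 * real n ^ 3 * real n powr (2 / (1 - \<alpha>))"
      by (simp add: power2_eq_square power3_eq_cube)
    also have "\<dots> \<le> (8 * \<bar>zs\<bar> + 26) * 2 * real n ^ 3 * real n powr (2 / (1 - \<alpha>))"
      by (intro mult_right_mono) (auto simp: R_def)
    finally show ?thesis .
  qed
  moreover have "g k \<in> borel_measurable borel" if "k \<in> K" for k
  proof -
    have [measurable]: "mix_dens \<alpha> (real_of_int (fst k) / m) (\<eta> * real_of_int (snd k)) \<in> borel_measurable borel"
      by (rule prob_densD(1)[OF prob_dens_mix]) (use a wt[OF that] in auto)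
    show ?thesis unfolding g_def by measurable
  qed
  moreover have "0 \<le> g k x" if "k \<in> K" for k x
    unfolding g_def using prob_densD(2)[OF prob_dens_mix[OF a(2) wt[OF that]]] by simp
  moreover have "J k \<in> sets borel" for k unfolding J_def by measurable
  moreover have "(\<integral>x. p x * indicator (J k) x \<partial>lborel) \<le> 1 / real n" for k
    using critical_set_mass[OF a ls r, of zs "\<eta> * real_of_int (snd k)"]
    unfolding J_def p_def ra by simp
  moreover have "\<exists>k\<in>K. \<forall>x. x \<notin> J k \<longrightarrow> q x \<le> g k x \<and> g k x \<le> (1 + 1 / real n)\<^sup>2 * q x"
    if q: "q \<in> model_dens \<alpha> D (10 / real n)" for q
  proof -
    obtain lam z where q: "q = mix_dens \<alpha> lam z" and lam: "10 / real n \<le> lam" "lam \<le> 1 - 10 / real n"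
      using q by (auto simp: model_dens_def)
    have "0 \<le> 10 / real n" by simp
    then have lam01: "0 \<le> lam" "lam \<le> 1" using lam by linarith+
    \<comment> \<open>\<open>lam\<close> and the truncated shift \<open>z0\<close> are rounded to \<open>l\<close> and \<open>w\<close>; the bracket carries their indices\<close>
    define z0 where "z0 = max (- R) (min R z)"
    have z0: "- R \<le> z0" "z0 \<le> R" using R by (auto simp: z0_def)
    define k where "k = (\<lfloor>lam * m\<rfloor>, \<lfloor>z0 / \<eta>\<rfloor>)"
    define l w where "l = real_of_int \<lfloor>lam * m\<rfloor> / m" and "w = \<eta> * real_of_int \<lfloor>z0 / \<eta>\<rfloor>"
    have "k \<in> K"
    proof -
      have "0 \<le> \<lfloor>lam * m\<rfloor>" using lam01 m by simp
      moreover have "\<lfloor>lam * m\<rfloor> \<le> \<lfloor>real_of_int (int n ^ 2)\<rfloor>"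
        using mult_right_mono[OF lam01(2), of m] m by (intro floor_mono) (simp add: m_def)
      moreover have "\<lfloor>- R / \<eta>\<rfloor> \<le> \<lfloor>z0 / \<eta>\<rfloor>" "\<lfloor>z0 / \<eta>\<rfloor> \<le> \<lfloor>R / \<eta>\<rfloor>"
        by (rule floor_mono, rule divide_right_mono; use z0 h in simp)+
      ultimately show ?thesis unfolding k_def K_def by (simp only: mem_Times_iff fst_conv snd_conv atLeastAtMost_iff floor_of_int)
    qed
    have lm: "l \<le> lam" "lam - 1 / m \<le> l"
    proof -
      have "real_of_int \<lfloor>lam * m\<rfloor> \<le> lam * m" "lam * m - 1 \<le> real_of_int \<lfloor>lam * m\<rfloor>" by linarith+
      then have "l \<le> lam * m / m" "(lam * m - 1) / m \<le> l"
        unfolding l_def using m by (intro divide_right_mono; simp)+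
      then show "l \<le> lam" "lam - 1 / m \<le> l" using m by (simp_all add: diff_divide_distrib)
    qed
    have l0: "0 \<le> l" using lam01 m by (simp add: l_def)
    have "\<epsilon> * (10 / real n) = 5 / 2 * (1 / m)" by (simp add: m_def \<epsilon>_def power2_eq_square)
    moreover have "0 \<le> 1 / m" using m by simp
    ultimately have em: "1 / m \<le> \<epsilon> * (10 / real n)" by linarith
    have l1: "(1 - \<epsilon>) * lam \<le> l"
      using lm em mult_left_mono[OF lam(1), of \<epsilon>] e by (simp add: algebra_simps)
    have "\<epsilon> * (10 / real n) \<le> \<epsilon> * (1 - lam)" using lam(2) e by (intro mult_left_mono) auto
    then have l2: "1 - l \<le> (1 + \<epsilon>) * (1 - lam)"
      using lm em by (simp add: algebra_simps)
    have zw: "\<bar>z0 - w\<bar> \<le> \<epsilon> * r"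
    proof -
      have "real_of_int \<lfloor>z0 / \<eta>\<rfloor> \<le> z0 / \<eta>" "z0 / \<eta> - 1 \<le> real_of_int \<lfloor>z0 / \<eta>\<rfloor>" by linarith+
      then have "w \<le> \<eta> * (z0 / \<eta>)" "\<eta> * (z0 / \<eta> - 1) \<le> w"
        unfolding w_def using h by (intro mult_left_mono; simp)+
      then have "w \<le> z0" "z0 - \<eta> \<le> w" using h by (simp_all add: right_diff_distrib)
      then show ?thesis by (simp add: \<eta>_def)
    qed
    have "q x \<le> g k x \<and> g k x \<le> (1 + 1 / real n)\<^sup>2 * q x" if x: "x \<notin> J k" for x
    proof -
      have xw: "r < \<bar>x - w\<bar>" "r < \<bar>\<bar>x - w\<bar> - 1\<bar>" and px: "mix_dens \<alpha> ls zs x \<noteq> 0"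
        using x by (auto simp: J_def k_def w_def p_def)
      have qx: "mix_dens \<alpha> lam z0 x = q x"
        unfolding q z0_def by (rule mix_dens_truncate_shift[OF px]) (simp add: R_def)
      note b = mix_dens_ratio[OF a r(1) e(1,2) zw xw l0 lm(1) lam01(2) l1 l2]
      have gk: "g k x = mix_dens \<alpha> l w x / (1 - \<epsilon>)\<^sup>2" by (simp add: g_def k_def l_def w_def)
      have q0: "0 \<le> q x" unfolding q by (rule prob_densD(2)[OF prob_dens_mix[OF a(2) lam01]])
      have "(1 + \<epsilon>) / (1 - \<epsilon>) \<le> 1 + 1 / real n"
      proof -
        have "1 / real n = 4 * \<epsilon>" by (simp add: \<epsilon>_def)
        moreover have "1 + \<epsilon> \<le> (1 + 4 * \<epsilon>) * (1 - \<epsilon>)"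
          using mult_left_mono[OF e(3), of \<epsilon>] e by (simp add: algebra_simps)
        ultimately show ?thesis using e by (simp add: pos_divide_le_eq)
      qed
      then have "((1 + \<epsilon>) / (1 - \<epsilon>))\<^sup>2 * q x \<le> (1 + 1 / real n)\<^sup>2 * q x"
        using e q0 by (intro mult_right_mono power_mono) auto
      then show ?thesis using b unfolding qx gk by linarith
    qed
    then show ?thesis using \<open>k \<in> K\<close> by blast
  qed
  ultimately show ?thesis using that[of K g J] unfolding bracketing_def by blast
qed

text \<open>The bias of the model is of order \<open>1 / n\<close> in \<open>L1\<close>: moving the weight into \<open>{10 / n..1 - 10 / n}\<close> costs
  at most \<open>10 / n\<close>, making it rational costs \<open>1 / n\<close>, and the density of the shifts makes the remaining
  error as small as desired.\<close>

lemma model_approximates: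
  assumes a: "0 < \<alpha>" "\<alpha> < 1" and ls: "0 \<le> ls" "ls \<le> 1" and n: "20 \<le> n" and D: "admissible_shifts \<alpha> D"
  obtains qb where "qb \<in> model_dens \<alpha> D (10 / real n)"
    "(\<integral>x. \<bar>mix_dens \<alpha> ls zs x - qb x\<bar> \<partial>lborel) \<le> 24 / real n"
proof -
  have n0: "20 \<le> real n" using n by simp
  define \<delta> where "\<delta> = 10 / real n"
  have d: "0 \<le> \<delta>" "\<delta> \<le> 1 / 2" "\<delta> \<in> \<rat>" using n0 by (auto simp: \<delta>_def field_simps)
  let ?s = "\<lambda>z x. s_dens \<alpha> (x - z)"
  have s: "prob_dens (?s z)" for z by (intro prob_dens_shift prob_dens_s_dens a)
  define t where "t = real_of_int \<lfloor>real n * ls\<rfloor> / real n"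
  have t: "0 \<le> t" "t \<le> ls" "ls - 1 / real n \<le> t"
  proof -
    have "real_of_int \<lfloor>real n * ls\<rfloor> \<le> real n * ls" "real n * ls - 1 \<le> real_of_int \<lfloor>real n * ls\<rfloor>" by linarith+
    then have "t \<le> real n * ls / real n" "(real n * ls - 1) / real n \<le> t"
      unfolding t_def by (intro divide_right_mono; simp)+
    then show "t \<le> ls" "ls - 1 / real n \<le> t" using n0 by (simp_all add: diff_divide_distrib)
    show "0 \<le> t" using ls by (simp add: t_def)
  qed
  define l where "l = max \<delta> (min (1 - \<delta>) t)"
  have l: "\<delta> \<le> l" "l \<le> 1 - \<delta>" "\<bar>t - l\<bar> \<le> \<delta>" using d t ls by (auto simp: l_def)
  have "t \<in> \<rat>" by (simp add: t_def)
  then have lQ: "l \<in> \<rat>" using d(3) by (auto simp: l_def max_def min_def)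
  have lt: "\<bar>ls - l\<bar> \<le> 11 / real n"
  proof -
    have "\<bar>ls - l\<bar> \<le> 1 / real n + \<delta>" using t l by linarith
    then show ?thesis by (simp add: \<delta>_def add_divide_distrib[symmetric])
  qed
  have "0 < sqrt (1 / (2 * (real n)\<^sup>2))" using n0 by simp
  \<comment> \<open>this accuracy makes the last term below of order \<open>1 / n\<close> when \<open>t = 2 n\<close> in the bound of \<open>L1\<close> by \<open>hell\<close>\<close>
  then obtain d where d: "d \<in> D" and hd: "hellinger lborel (law (?s zs)) (law (?s d)) < sqrt (1 / (2 * (real n)\<^sup>2))"
    using D unfolding admissible_shifts_def by blast
  have "hell (?s zs) (?s d) < 1 / (2 * (real n)\<^sup>2)"
    using hd hellinger_sq_law[OF s s, of zs d] by (simp only: hellinger_def real_sqrt_less_iff)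
  then have "2 * real n * hell (?s zs) (?s d) \<le> 2 * real n * (1 / (2 * (real n)\<^sup>2))"
    by (intro mult_left_mono) auto
  also have "\<dots> = 1 / real n" using n0 by (simp add: power2_eq_square)
  finally have "(\<integral>x. \<bar>?s zs x - ?s d x\<bar> \<partial>lborel) \<le> 2 / real n"
    using L1_le_hell[OF s s, of "2 * real n" zs d] n0 by simp
  note sd = this
  have i: "integrable lborel (\<lambda>x. \<bar>?s zs x - ?s d x\<bar>)" "integrable lborel (?s zs)" "integrable lborel (s_dens \<alpha>)"
    using prob_densD(3)[OF s[of zs]] prob_densD(3)[OF s[of d]] prob_densD(3)[OF s[of 0]] by auto
  have l01: "0 \<le> l" "l \<le> 1" using l \<open>0 \<le> \<delta>\<close> by auto
  have "(\<integral>x. \<bar>mix_dens \<alpha> ls zs x - mix_dens \<alpha> l d x\<bar> \<partial>lborel)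
      \<le> (\<integral>x. 11 / real n * (s_dens \<alpha> x + ?s zs x) + \<bar>?s zs x - ?s d x\<bar> \<partial>lborel)"
  proof (rule integral_mono)
    show "integrable lborel (\<lambda>x. \<bar>mix_dens \<alpha> ls zs x - mix_dens \<alpha> l d x\<bar>)"
      using prob_densD(3)[OF prob_dens_mix[OF a(2) ls, of zs]] prob_densD(3)[OF prob_dens_mix[OF a(2) l01, of d]]
      by auto
    show "integrable lborel (\<lambda>x. 11 / real n * (s_dens \<alpha> x + ?s zs x) + \<bar>?s zs x - ?s d x\<bar>)"
      using i by auto
    fix x
    have nn: "0 \<le> s_dens \<alpha> x" "0 \<le> ?s zs x" using s_dens_nonneg[OF a(2)] by auto
    have "mix_dens \<alpha> ls zs x - mix_dens \<alpha> l d x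
        = (ls - l) * (?s zs x - s_dens \<alpha> x) + l * (?s zs x - ?s d x)"
      by (simp add: mix_dens_def algebra_simps)
    also have "\<bar>\<dots>\<bar> \<le> \<bar>ls - l\<bar> * \<bar>?s zs x - s_dens \<alpha> x\<bar> + \<bar>l\<bar> * \<bar>?s zs x - ?s d x\<bar>"
      by (metis abs_mult abs_triangle_ineq)
    also have "\<dots> \<le> 11 / real n * (s_dens \<alpha> x + ?s zs x) + 1 * \<bar>?s zs x - ?s d x\<bar>"
      using lt l01 nn n0 by (intro add_mono mult_mono) auto
    finally show "\<bar>mix_dens \<alpha> ls zs x - mix_dens \<alpha> l d x\<bar>
        \<le> 11 / real n * (s_dens \<alpha> x + ?s zs x) + \<bar>?s zs x - ?s d x\<bar>" by simp
  qed
  also have "\<dots> = 11 / real n * (1 + 1) + (\<integral>x. \<bar>?s zs x - ?s d x\<bar> \<partial>lborel)"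
    using i prob_densD(4)[OF s[of zs]] prob_densD(4)[OF s[of 0]] by simp
  also have "\<dots> \<le> 24 / real n" using sd by (simp add: add_divide_distrib[symmetric])
  finally have "(\<integral>x. \<bar>mix_dens \<alpha> ls zs x - mix_dens \<alpha> l d x\<bar> \<partial>lborel) \<le> 24 / real n" .
  moreover have "mix_dens \<alpha> l d \<in> model_dens \<alpha> D (10 / real n)"
    unfolding model_dens_def using l lQ d by (intro CollectI exI[of _ l] exI[of _ d]) (simp add: \<delta>_def)
  ultimately show ?thesis using that by blast
qed

section \<open>Estimation of the weight and of the shift\<close>

lemma with_prob_at_least_mono:
  assumes "with_prob_at_least M p E" and "\<And>\<omega>. \<omega> \<in> space M \<Longrightarrow> E \<omega> \<Longrightarrow> F \<omega>"
  shows "with_prob_at_least M p F"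
  using assms unfolding with_prob_at_least_def by blast

text \<open>The logarithm of the polynomial number of brackets produces the term \<open>ln n\<close>, which also absorbs all
  additive constants since it is at least one.\<close>

lemma rho_estimator_hell_le:
  assumes a: "0 < \<alpha>" "\<alpha> < 1" and ls: "0 \<le> ls" "ls \<le> 1"
  obtains C where "0 < C"
    "\<And>D (n::nat) (M::'a measure) X Phat lamhat zhat \<xi>.
      admissible_shifts \<alpha> D \<Longrightarrow> 20 \<le> n \<Longrightarrow> iid_sample M n X (mix_law \<alpha> ls zs) \<Longrightarrow>
      rho_estimator (model_dens \<alpha> D (10 / real n)) n Phat \<Longrightarrow>
      (\<And>x. x \<in> space (\<Pi>\<^sub>M i\<in>{1..n}. (borel :: real measure)) \<Longrightarrow>
         lamhat x \<in> {0..1} \<and> Phat x = mix_law \<alpha> (lamhat x) (zhat x)) \<Longrightarrow> 0 < \<xi> \<Longrightarrow>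
      with_prob_at_least M (1 - exp (- \<xi>)) (\<lambda>\<omega>.
        let x = (\<lambda>i\<in>{1..n}. X i \<omega>) in
        hell (mix_dens \<alpha> ls zs) (mix_dens \<alpha> (lamhat x) (zhat x)) \<le> C * ((ln (real n) + \<xi>) / real n))"
proof -
  define c where "c = (8 * \<bar>zs\<bar> + 26) * 2"
  define \<kappa> where "\<kappa> = ln c + 3 + 2 / (1 - \<alpha>)"
  have c: "1 \<le> c" by (simp add: c_def)
  have k: "0 \<le> \<kappa>" using c a by (simp add: \<kappa>_def)
  define C where "C = 1780 + 32 * \<kappa>"
  have "0 < C" using k by (simp add: C_def)
  moreover have "with_prob_at_least M (1 - exp (- \<xi>)) (\<lambda>\<omega>.
        let x = (\<lambda>i\<in>{1..n}. X i \<omega>) in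
        hell (mix_dens \<alpha> ls zs) (mix_dens \<alpha> (lamhat x) (zhat x)) \<le> C * ((ln (real n) + \<xi>) / real n))"
    if D: "admissible_shifts \<alpha> D" and n: "20 \<le> n" and iid: "iid_sample M n X (mix_law \<alpha> ls zs)"
      and rho: "rho_estimator (model_dens \<alpha> D (10 / real n)) n Phat"
      and par: "\<And>x. x \<in> space (\<Pi>\<^sub>M i\<in>{1..n}. (borel :: real measure)) \<Longrightarrow>
         lamhat x \<in> {0..1} \<and> Phat x = mix_law \<alpha> (lamhat x) (zhat x)"
      and xi: "0 < \<xi>"
    for D and n :: nat and M :: "'a measure" and X Phat lamhat zhat \<xi>
  proof -
    let ?p = "mix_dens \<alpha> ls zs" and ?Q = "model_dens \<alpha> D (10 / real n)"
    have n0: "0 < n" "20 \<le> real n" using n by auto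
    have p: "prob_dens ?p" using a ls by (intro prob_dens_mix)
    have Q: "prob_dens q" if q: "q \<in> ?Q" for q
    proof -
      obtain lam z where *: "q = mix_dens \<alpha> lam z" "10 / real n \<le> lam" "lam \<le> 1 - 10 / real n"
        using q by (auto simp: model_dens_def)
      have "0 \<le> 10 / real n" by simp
      then have "0 \<le> lam" "lam \<le> 1" using * by linarith+
      then show ?thesis unfolding *(1) using a by (intro prob_dens_mix)
    qed
    define N where "N = c * real n ^ 3 * real n powr (2 / (1 - \<alpha>))"
    have N0: "0 < N" using c n0 by (simp add: N_def)
    have ln1: "1 \<le> ln (real n)"
    proof -
      have "exp 1 \<le> real n" using exp_le n0 by linarith
      then show ?thesis using n0 by (simp add: ln_ge_iff)
    qed
    have lnN: "ln N \<le> \<kappa> * ln (real n)"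
    proof -
      have "ln N = ln c + 3 * ln (real n) + 2 / (1 - \<alpha>) * ln (real n)"
        using c n0 by (simp add: N_def ln_mult ln_powr ln_realpow)
      also have "ln c \<le> ln c * ln (real n)" using c ln1 mult_left_mono[OF ln1, of "ln c"] by simp
      finally show ?thesis by (simp add: \<kappa>_def algebra_simps)
    qed
    obtain qb where qb: "qb \<in> ?Q" and L1: "(\<integral>x. \<bar>?p x - qb x\<bar> \<partial>lborel) \<le> 24 / real n"
      using model_approximates[OF a ls n D] by blast
    obtain K :: "(int \<times> int) set" and g J where br: "bracketing n ?p ?Q K g J"
      and card: "real (card K) \<le> N"
      using model_brackets[OF a ls n, where zs=zs and D=D] unfolding N_def c_def by blast
    define L where "L = 2 * 24 + 3 + ln N + \<xi>"
    have "with_prob_at_least M (1 - exp (- \<xi>)) (\<lambda>\<omega>. \<forall>q\<in>?Q.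
        T_stat n (\<lambda>i\<in>{1..n}. X i \<omega>) qb q \<le> 2 * (2 * 24 + 3 + ln N + \<xi>) - real n * hell q qb / 2)"
      by (rule uniform_T_stat_bound[OF iid[unfolded mix_law_def] p Q[OF qb] n0(1) Q br card N0 L1])
    then show ?thesis
    proof (rule with_prob_at_least_mono)
      fix \<omega>
      assume w: "\<omega> \<in> space M" and T: "\<forall>q\<in>?Q. T_stat n (\<lambda>i\<in>{1..n}. X i \<omega>) qb q
        \<le> 2 * (2 * 24 + 3 + ln N + \<xi>) - real n * hell q qb / 2"
      define x where "x = (\<lambda>i\<in>{1..n}. X i \<omega>)"
      have x: "x \<in> space (\<Pi>\<^sub>M i\<in>{1..n}. (borel :: real measure))" by (simp add: x_def space_PiM)
      have f: "prob_dens (mix_dens \<alpha> (lamhat x) (zhat x))" using par[OF x] a by (intro prob_dens_mix) auto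
      have cl: "law (mix_dens \<alpha> (lamhat x) (zhat x)) \<in> hellinger_closure (near_minimizers ?Q n x)"
        using rho x par[OF x] by (auto simp: rho_estimator_def mix_law_def)
      have "T_stat n x qb q \<le> 2 * L - real n * hell q qb / 2" if "q \<in> ?Q" for q
        using T that by (simp add: x_def L_def)
      from rho_estimate_hell_le[OF n0(1) p f qb Q L1 this cl]
      have "hell ?p (mix_dens \<alpha> (lamhat x) (zhat x)) \<le> (32 * L + 68 + 2 * 24) / real n" .
      also have "\<dots> \<le> C * (ln (real n) + \<xi>) / real n"
      proof (rule divide_right_mono)
        have "0 \<le> (1748 + 32 * \<kappa>) * \<xi>" using k xi by simp
        then show "32 * L + 68 + 2 * 24 \<le> C * (ln (real n) + \<xi>)"
          using lnN ln1 by (simp add: L_def C_def algebra_simps)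
      qed simp
      finally show "let x = (\<lambda>i\<in>{1..n}. X i \<omega>) in
          hell ?p (mix_dens \<alpha> (lamhat x) (zhat x)) \<le> C * ((ln (real n) + \<xi>) / real n)"
        by (simp add: x_def Let_def)
    qed
  qed
  ultimately show ?thesis using that by blast
qed

theorem theorem7:
  fixes \<alpha> lamstar zstar :: real
  assumes "0 < \<alpha>" and "\<alpha> < 1"
    and "0 < lamstar" and "lamstar \<le> 1"
    and "zstar \<noteq> 0"
  shows "\<exists>C>0. \<forall>D (n::nat) (M::'a measure) X Phat lamhat zhat.
    admissible_shifts \<alpha> D \<and> n \<ge> 20 \<and>
    iid_sample M n X (mix_law \<alpha> lamstar zstar) \<and>
    rho_estimator (model_dens \<alpha> D (10 / real n)) n Phat \<and>
    (\<forall>x \<in> space (\<Pi>\<^sub>M i\<in>{1..n}. (borel :: real measure)).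
       lamhat x \<in> {0..1} \<and> Phat x = mix_law \<alpha> (lamhat x) (zhat x))
    \<longrightarrow> (\<forall>\<xi>>0. with_prob_at_least M (1 - exp (- \<xi>)) (\<lambda>\<omega>.
          let x = (\<lambda>i\<in>{1..n}. X i \<omega>) in
          C * (min 1 (\<bar>zhat x - zstar\<bar> powr (1 - \<alpha>)) + (lamstar - lamhat x)\<^sup>2)
            \<le> (ln (real n) + \<xi>) / real n))"
proof -
  obtain c where c: "0 < c" and lower: "\<And>lam z. 0 \<le> lam \<Longrightarrow> lam \<le> 1 \<Longrightarrow>
      c * (min 1 (\<bar>z - zstar\<bar> powr (1 - \<alpha>)) + (lamstar - lam)\<^sup>2)
        \<le> hell (mix_dens \<alpha> lamstar zstar) (mix_dens \<alpha> lam z)"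
    using hell_mix_ge[OF assms] by blast
  obtain C where C: "0 < C" and upper: "\<And>D (n::nat) (M::'a measure) X Phat lamhat zhat \<xi>.
      admissible_shifts \<alpha> D \<Longrightarrow> 20 \<le> n \<Longrightarrow> iid_sample M n X (mix_law \<alpha> lamstar zstar) \<Longrightarrow>
      rho_estimator (model_dens \<alpha> D (10 / real n)) n Phat \<Longrightarrow>
      (\<And>x. x \<in> space (\<Pi>\<^sub>M i\<in>{1..n}. (borel :: real measure)) \<Longrightarrow>
         lamhat x \<in> {0..1} \<and> Phat x = mix_law \<alpha> (lamhat x) (zhat x)) \<Longrightarrow> 0 < \<xi> \<Longrightarrow>
      with_prob_at_least M (1 - exp (- \<xi>)) (\<lambda>\<omega>.
        let x = (\<lambda>i\<in>{1..n}. X i \<omega>) in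
        hell (mix_dens \<alpha> lamstar zstar) (mix_dens \<alpha> (lamhat x) (zhat x)) \<le> C * ((ln (real n) + \<xi>) / real n))"
    using rho_estimator_hell_le[OF assms(1,2) less_imp_le[OF assms(3)] assms(4)] by blast
  show ?thesis
  proof (intro exI[of _ "c / C"] conjI allI impI)
    show "0 < c / C" using c C by simp
    fix D and n :: nat and M :: "'a measure" and X Phat lamhat zhat and \<xi> :: real
    assume H: "admissible_shifts \<alpha> D \<and> n \<ge> 20 \<and>
      iid_sample M n X (mix_law \<alpha> lamstar zstar) \<and>
      rho_estimator (model_dens \<alpha> D (10 / real n)) n Phat \<and>
      (\<forall>x \<in> space (\<Pi>\<^sub>M i\<in>{1..n}. (borel :: real measure)).
         lamhat x \<in> {0..1} \<and> Phat x = mix_law \<alpha> (lamhat x) (zhat x))" and xi: "0 < \<xi>"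
    have "with_prob_at_least M (1 - exp (- \<xi>)) (\<lambda>\<omega>.
        let x = (\<lambda>i\<in>{1..n}. X i \<omega>) in
        hell (mix_dens \<alpha> lamstar zstar) (mix_dens \<alpha> (lamhat x) (zhat x)) \<le> C * ((ln (real n) + \<xi>) / real n))"
      by (rule upper[of D n M X Phat lamhat zhat \<xi>]) (use H xi in auto)
    then show "with_prob_at_least M (1 - exp (- \<xi>)) (\<lambda>\<omega>.
          let x = (\<lambda>i\<in>{1..n}. X i \<omega>) in
          c / C * (min 1 (\<bar>zhat x - zstar\<bar> powr (1 - \<alpha>)) + (lamstar - lamhat x)\<^sup>2)
            \<le> (ln (real n) + \<xi>) / real n)"
    proof (rule with_prob_at_least_mono)
      fix \<omega>
      assume "\<omega> \<in> space M"
      define x where "x = (\<lambda>i\<in>{1..n}. X i \<omega>)"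
      assume "let x = (\<lambda>i\<in>{1..n}. X i \<omega>) in
        hell (mix_dens \<alpha> lamstar zstar) (mix_dens \<alpha> (lamhat x) (zhat x)) \<le> C * ((ln (real n) + \<xi>) / real n)"
      then have up: "hell (mix_dens \<alpha> lamstar zstar) (mix_dens \<alpha> (lamhat x) (zhat x)) \<le> C * ((ln (real n) + \<xi>) / real n)"
        by (simp add: x_def Let_def)
      have "x \<in> space (\<Pi>\<^sub>M i\<in>{1..n}. (borel :: real measure))" by (simp add: x_def space_PiM)
      then have "lamhat x \<in> {0..1}" using H by blast
      then have "c * (min 1 (\<bar>zhat x - zstar\<bar> powr (1 - \<alpha>)) + (lamstar - lamhat x)\<^sup>2)
          \<le> C * ((ln (real n) + \<xi>) / real n)"
        using lower[of "lamhat x" "zhat x"] up by auto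
      then have "c / C * (min 1 (\<bar>zhat x - zstar\<bar> powr (1 - \<alpha>)) + (lamstar - lamhat x)\<^sup>2)
          \<le> (ln (real n) + \<xi>) / real n"
        using C by (simp add: pos_divide_le_eq mult.commute)
      then show "let x = (\<lambda>i\<in>{1..n}. X i \<omega>) in
          c / C * (min 1 (\<bar>zhat x - zstar\<bar> powr (1 - \<alpha>)) + (lamstar - lamhat x)\<^sup>2)
            \<le> (ln (real n) + \<xi>) / real n"
        by (simp add: x_def Let_def)
    qed
  qed
qed

end
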